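(* Let $X$ be a nonempty set. (a) The strong bimonoids $\mathsf{FB}(X)=\mathrm{T}(X)/{=_E}$ and $\mathsf{N}_{\mathrm{sb}}[X]=(\mathbb{N}_{\mathrm{sb}}[X],+,\times,0,1)$ are isomorphic. (b) The strong bimonoid $\mathsf{FB}_{\mathrm{rd}}(X)=\mathrm{T}(X)/{=_{E_{\mathrm{rd}}}}$ and the strong bimonoid $\mathsf{N}_{\mathrm{rd}}[X]=(\mathbb{N}_{\mathrm{rd}}[X],+,\times_{\mathrm{rd}},0,1)$ of polynomials are isomorphic. (c) The strong bimonoid $\mathsf{FB}_{\mathrm{id,rd}}(X)=\mathrm{T}(X)/{=_{E_{\mathrm{id,rd}}}}$ and the strong bimonoid $\mathsf{B}_{\mathrm{id,rd}}[X]=(\mathbb{B}_{\mathrm{id,rd}}[X],+_{\mathrm{id}},\times_{\mathrm{rd}},0,1)$ of id-reduced polynomials are isomorphic.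
   Context: A strong bimonoid is an algebra $(B,\oplus,\otimes,\mathbf 0,\mathbf 1)$ such that $(B,\oplus,\mathbf 0)$ is a commutative monoid, $(B,\otimes,\mathbf 1)$ is a monoid, and $b\otimes\mathbf 0=\mathbf 0\otimes b=\mathbf 0$ for all $b$. Isomorphisms preserve both operations and both constants. Terms and congruences. $\mathrm{T}(X)$ is the set (and term algebra) of all terms built from elements of $X$, constants $\hat 0,\hat 1$, and binary symbols $\hat+,\hat\times$ (infix). $\mathrm{size}(t)$ is the total number of occurrences of symbols in $t$. $=_E$ is the smallest congruence on the term algebra $\mathrm{T}(X)$ containing, for all $a,b,c\in \mathrm{T}(X)$, the pairs $(a\hat+(b\hat+c),(a\hat+b)\hat+c)$, $(a\hat+b,b\hat+a)$, $(a\hat+\hat0,a)$, $(a\hat\times(b\hat\times c),(a\hat\times b)\hat\times c)$, $(\hat1\hat\times a,a)$, $(a\hat\times\hat1,a)$, $(a\hat\times\hat0,\hat0)$, $(\hat0\hat\times a,\hat0)$. $=_{E_{\mathrm{rd}}}$ is the smallest congruence containing these pairs and all $((a\hat+b)\hat\times c,(a\hat\times c)\hat+(b\hat\times c))$. $=_{E_{\mathrm{id,rd}}}$ is the smallest congruence containing all the previous pairs and all $(a\hat+a,a)$. The quotients carry the induced operations. Simple terms. $s\in \mathrm{T}(X)$ is simple if $s=\hat 0$, or $s$ contains neither $\hat 0$ nor any subterm of the form $\hat 1\hat\times s'$ or $s'\hat\times\hat 1$. $\mathrm{ST}(X)$ is the set of simple terms. For $s,t\in \mathrm{ST}(X)$,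 $s=_{\mathrm{AC}}t$ means that $t$ is obtained from $s$ by finitely many steps, each replacing a subterm occurrence using, in either direction, one of: $a\hat+(b\hat+c)\leftrightarrow(a\hat+b)\hat+c$, $a\hat+b\leftrightarrow b\hat+a$, $a\hat\times(b\hat\times c)\leftrightarrow(a\hat\times b)\hat\times c$. $[s]_{\mathrm{AC}}$ is the class of $s$; $\mathbb{N}_{\mathrm{sb}}[X]=\mathrm{ST}(X)/{=_{\mathrm{AC}}}$; $0=[\hat 0]_{\mathrm{AC}}$, $1=[\hat 1]_{\mathrm{AC}}$; $X/\mathrm{AC}=\{[x]_{\mathrm{AC}}\mid x\in X\}$; $\mathrm{size}([s]_{\mathrm{AC}})=\mathrm{size}(s)$ (well defined). Operations on $\mathbb{N}_{\mathrm{sb}}[X]$: $p+0=0+p=p$, and $[s]_{\mathrm{AC}}+[t]_{\mathrm{AC}}=[s\hat+t]_{\mathrm{AC}}$ for $s,t\neq\hat 0$; $p\times 0=0\times p=0$, $p\times1=1\times p=p$, and $[s]_{\mathrm{AC}}\times[t]_{\mathrm{AC}}=[s\hat\times t]_{\mathrm{AC}}$ for $s,t\notin\{\hat 0,\hat 1\}$. Polynomials. A monomial term is a term built from elements of $X$ using only $\hat\times$; a monomial is the class of a monomial term. The set $\mathrm{PT}(X)$ of polynomial terms is the smallest $U\subseteq \mathrm{ST}(X)$ with: (a) $\hat 0,\hat 1$ and all monomial terms are in $U$; (b) if $s,t\in U\setminus\{\hat 0\}$ then $s\hat+t\in U$; (c) if $s$ is a monomial term and $t\in U\setminus\{\hat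 0,\hat 1\}$ then $s\hat\times t\in U$. Terms arising by (b) (resp. (c)) are sum (resp. product) polynomial terms. $\mathbb{N}_{\mathrm{rd}}[X]=\{[t]_{\mathrm{AC}}\mid t\in \mathrm{PT}(X)\}$ (polynomials), closed under $+$; classes of sum (product) polynomial terms are sum (product) polynomials. Facts making the next definition meaningful: every polynomial outside $X/\mathrm{AC}\cup\{0,1\}$ is exactly one of a sum polynomial or a product polynomial; each sum polynomial is $q_1+\dots+q_n$ with $n\ge2$ and each $q_i$ a product polynomial or in $X/\mathrm{AC}\cup\{1\}$, uniquely up to permutation; each product polynomial that is not a monomial is $m\times q'$ for a unique monomial $m$ and unique sum polynomial $q'$. Multiplication $\times_{\mathrm{rd}}$ on $\mathbb{N}_{\mathrm{rd}}[X]$, by induction on $\mathrm{size}(q)$: $q\times_{\mathrm{rd}}0=0\times_{\mathrm{rd}}q=0$, $q\times_{\mathrm{rd}}1=1\times_{\mathrm{rd}}q=q$; for $q,r\notin\{0,1\}$: if $q$ is a monomial, $q\times_{\mathrm{rd}}r=q\times r$; if $q$ is a sum polynomial, written as $q=q_1+\dots+q_n$ with $n\ge2$ and each $q_i$ a product polynomial or in $X/\mathrm{AC}\cup\{1\}$, $q\times_{\mathrm{rd}}r=q_1\times_{\mathrm{rd}}r+\dots+q_n\times_{\mathrm{rd}}r$; if $q=m\times q'$ with $m$ a monomial and $q'$ a sum polynomial, $q\times_{\mathrm{rd}}r=m\times(q'\times_{\mathrm{rd}}r)$. Id-reduced polynomials. A sum term is a simple term $s_1\hat+s_2$ with $s_1,s_2\in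 \mathrm{ST}(X)\setminus\{\hat 0\}$; a product term is a simple term $s_1\hat\times s_2$ with $s_1,s_2\in \mathrm{ST}(X)\setminus\{\hat0,\hat1\}$. Each sum term is, up to omitted parentheses, uniquely $t_1\hat+\cdots\hat+t_n$ ($n\ge2$) with every $t_i$ a product term or in $X\cup\{\hat 1\}$ (its sum-product decomposition). $\mathrm{ST}_{\mathrm{id}}(X)$ is the smallest $U\subseteq \mathrm{ST}(X)$ with: (a) $\hat0,\hat1$ and all monomial terms are in $U$; (b) if $t$ is a sum term with sum-product decomposition $t_1\hat+\cdots\hat+t_n$, all $t_i\in U$, and $t_i\neq_{\mathrm{AC}}t_j$ for $i<j$, then $t\in U$; (c) if $s,t\in U\setminus\{\hat0,\hat1\}$ then $s\hat\times t\in U$. $\mathrm{PT}_{\mathrm{id}}(X)=\mathrm{PT}(X)\cap \mathrm{ST}_{\mathrm{id}}(X)$, and $\mathbb{B}_{\mathrm{id,rd}}[X]=\{[t]_{\mathrm{AC}}\mid t\in \mathrm{PT}_{\mathrm{id}}(X)\}\subseteq\mathbb{N}_{\mathrm{rd}}[X]$ is the set of id-reduced polynomials; it is closed under $\times_{\mathrm{rd}}$. Addition $+_{\mathrm{id}}$ on $\mathbb{B}_{\mathrm{id,rd}}[X]$: $q+_{\mathrm{id}}0=0+_{\mathrm{id}}q=q$. For $q,r\ne0$ write $q=q_1+\dots+q_k$ and $r=r_1+\dots+r_n$ ($k,n\ge1$) with the $q_i$ pairwise different, the $r_j$ pairwise different, each being $1$, a monomial, or an id-reduced product polynomial; then $q+_{\mathrm{id}}r=q_1+\dots+q_k+r_{i_1}+\dots+r_{i_\ell}$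 where $\{i_1,\dots,i_\ell\}$ is the maximal subset of $\{1,\dots,n\}$ with $\{q_1,\dots,q_k\}\cap\{r_{i_1},\dots,r_{i_\ell}\}=\emptyset$. *)

theory Defs
  imports "HOL-Algebra.QuotRing"
begin

section \<open>Strong bimonoids\<close>

locale strong_bimonoid = abelian_monoid R + monoid R for R (structure) +
  assumes l_null: "b \<in> carrier R \<Longrightarrow> \<zero> \<otimes> b = \<zero>"
    and r_null: "b \<in> carrier R \<Longrightarrow> b \<otimes> \<zero> = \<zero>"

text \<open>The library's \<^const>\<open>ring_iso\<close> does not mention the constant zero.\<close>

definition bimonoid_iso :: "('a, 'm) ring_scheme \<Rightarrow> ('b, 'n) ring_scheme \<Rightarrow> ('a \<Rightarrow> 'b) set" where
  "bimonoid_iso R S = {h \<in> ring_iso R S. h \<zero>\<^bsub>R\<^esub> = \<zero>\<^bsub>S\<^esub>}"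

definition isomorphic_bimonoids :: "('a, 'm) ring_scheme \<Rightarrow> ('b, 'n) ring_scheme \<Rightarrow> bool"
    (infix \<open>\<cong>\<^sub>s\<^sub>b\<close> 60) where
  "R \<cong>\<^sub>s\<^sub>b S \<longleftrightarrow> bimonoid_iso R S \<noteq> {}"


section \<open>Terms and the free strong bimonoids\<close>

datatype (vars: 'a) tm =
    Var 'a
  | Zero
  | One
  | Add "'a tm" "'a tm"  (infixl \<open>\<^bold>+\<close> 65)
  | Mul "'a tm" "'a tm"  (infixl \<open>\<^bold>\<times>\<close> 70)

definition T :: "'a set \<Rightarrow> 'a tm set" where
  "T X = {t. vars t \<subseteq> X}"

definition term_congruence :: "'a set \<Rightarrow> ('a tm \<times> 'a tm) set \<Rightarrow> bool" where
  "term_congruence X R \<longleftrightarrow> equiv (T X) R \<and>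
     (\<forall>s s' t t'. (s, s') \<in> R \<and> (t, t') \<in> R \<longrightarrow>
        (s \<^bold>+ t, s' \<^bold>+ t') \<in> R \<and> (s \<^bold>\<times> t, s' \<^bold>\<times> t') \<in> R)"

definition congruence_generated_by ::
    "'a set \<Rightarrow> ('a tm \<times> 'a tm) set \<Rightarrow> ('a tm \<times> 'a tm) set" where
  "congruence_generated_by X P = \<Inter>{R. term_congruence X R \<and> P \<subseteq> R}"

definition E_pairs :: "'a set \<Rightarrow> ('a tm \<times> 'a tm) set" where
  "E_pairs X =
     {(a \<^bold>+ (b \<^bold>+ c), (a \<^bold>+ b) \<^bold>+ c) | a b c. a \<in> T X \<and> b \<in> T X \<and> c \<in> T X} \<union>
     {(a \<^bold>+ b, b \<^bold>+ a) | a b. a \<in> T X \<and> b \<in> T X} \<union>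
     {(a \<^bold>+ Zero, a) | a. a \<in> T X} \<union>
     {(a \<^bold>\<times> (b \<^bold>\<times> c), (a \<^bold>\<times> b) \<^bold>\<times> c) | a b c. a \<in> T X \<and> b \<in> T X \<and> c \<in> T X} \<union>
     {(One \<^bold>\<times> a, a) | a. a \<in> T X} \<union>
     {(a \<^bold>\<times> One, a) | a. a \<in> T X} \<union>
     {(a \<^bold>\<times> Zero, Zero) | a. a \<in> T X} \<union>
     {(Zero \<^bold>\<times> a, Zero) | a. a \<in> T X}"

definition rd_pairs :: "'a set \<Rightarrow> ('a tm \<times> 'a tm) set" where
  "rd_pairs X =
     {((a \<^bold>+ b) \<^bold>\<times> c, (a \<^bold>\<times> c) \<^bold>+ (b \<^bold>\<times> c)) | a b c. a \<in> T X \<and> b \<in> T X \<and> c \<in> T X}"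

definition id_pairs :: "'a set \<Rightarrow> ('a tm \<times> 'a tm) set" where
  "id_pairs X = {(a \<^bold>+ a, a) | a. a \<in> T X}"

definition eq_E :: "'a set \<Rightarrow> ('a tm \<times> 'a tm) set" where
  "eq_E X = congruence_generated_by X (E_pairs X)"

definition eq_E_rd :: "'a set \<Rightarrow> ('a tm \<times> 'a tm) set" where
  "eq_E_rd X = congruence_generated_by X (E_pairs X \<union> rd_pairs X)"

definition eq_E_id_rd :: "'a set \<Rightarrow> ('a tm \<times> 'a tm) set" where
  "eq_E_id_rd X = congruence_generated_by X (E_pairs X \<union> rd_pairs X \<union> id_pairs X)"

text \<open>The union over all representatives is the class of the result: for a congruence
  all the classes in the union coincide.\<close>

definition quotient_algebra :: "'a set \<Rightarrow> ('a tm \<times> 'a tm) set \<Rightarrow> 'a tm set ring" where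
  "quotient_algebra X R =
     \<lparr>carrier = T X // R,
      mult = (\<lambda>A B. \<Union>s\<in>A. \<Union>t\<in>B. R `` {s \<^bold>\<times> t}),
      one = R `` {One},
      zero = R `` {Zero},
      add = (\<lambda>A B. \<Union>s\<in>A. \<Union>t\<in>B. R `` {s \<^bold>+ t})\<rparr>"

definition FB :: "'a set \<Rightarrow> 'a tm set ring" where
  "FB X = quotient_algebra X (eq_E X)"

definition FB_rd :: "'a set \<Rightarrow> 'a tm set ring" where
  "FB_rd X = quotient_algebra X (eq_E_rd X)"

definition FB_id_rd :: "'a set \<Rightarrow> 'a tm set ring" where
  "FB_id_rd X = quotient_algebra X (eq_E_id_rd X)"


section \<open>Simple terms modulo associativity and commutativity\<close>

fun subterms :: "'a tm \<Rightarrow> 'a tm set" where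
  "subterms (s \<^bold>+ t) = insert (s \<^bold>+ t) (subterms s \<union> subterms t)"
| "subterms (s \<^bold>\<times> t) = insert (s \<^bold>\<times> t) (subterms s \<union> subterms t)"
| "subterms t = {t}"

definition simple :: "'a tm \<Rightarrow> bool" where
  "simple s \<longleftrightarrow> s = Zero \<or>
     (Zero \<notin> subterms s \<and> (\<forall>s'. One \<^bold>\<times> s' \<notin> subterms s \<and> s' \<^bold>\<times> One \<notin> subterms s))"

definition ST :: "'a set \<Rightarrow> 'a tm set" where
  "ST X = {s \<in> T X. simple s}"

inductive ac_step :: "'a tm \<Rightarrow> 'a tm \<Rightarrow> bool" where
  add_assoc: "ac_step (a \<^bold>+ (b \<^bold>+ c)) ((a \<^bold>+ b) \<^bold>+ c)"
| add_assoc': "ac_step ((a \<^bold>+ b) \<^bold>+ c) (a \<^bold>+ (b \<^bold>+ c))"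
| add_comm: "ac_step (a \<^bold>+ b) (b \<^bold>+ a)"
| mul_assoc: "ac_step (a \<^bold>\<times> (b \<^bold>\<times> c)) ((a \<^bold>\<times> b) \<^bold>\<times> c)"
| mul_assoc': "ac_step ((a \<^bold>\<times> b) \<^bold>\<times> c) (a \<^bold>\<times> (b \<^bold>\<times> c))"
| add_left: "ac_step s s' \<Longrightarrow> ac_step (s \<^bold>+ t) (s' \<^bold>+ t)"
| add_right: "ac_step t t' \<Longrightarrow> ac_step (s \<^bold>+ t) (s \<^bold>+ t')"
| mul_left: "ac_step s s' \<Longrightarrow> ac_step (s \<^bold>\<times> t) (s' \<^bold>\<times> t)"
| mul_right: "ac_step t t' \<Longrightarrow> ac_step (s \<^bold>\<times> t) (s \<^bold>\<times> t')"

definition eq_AC :: "'a set \<Rightarrow> ('a tm \<times> 'a tm) set" where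
  "eq_AC X = {(s, t). s \<in> ST X \<and> t \<in> ST X \<and> ac_step\<^sup>*\<^sup>* s t}"

definition AC_class :: "'a set \<Rightarrow> 'a tm \<Rightarrow> 'a tm set" where
  "AC_class X s = eq_AC X `` {s}"

definition Nsb_carrier :: "'a set \<Rightarrow> 'a tm set set" where
  "Nsb_carrier X = ST X // eq_AC X"

definition zero_AC :: "'a set \<Rightarrow> 'a tm set" where
  "zero_AC X = AC_class X Zero"

definition one_AC :: "'a set \<Rightarrow> 'a tm set" where
  "one_AC X = AC_class X One"

definition add_AC :: "'a set \<Rightarrow> 'a tm set \<Rightarrow> 'a tm set \<Rightarrow> 'a tm set" where
  "add_AC X p q =
     (if p = zero_AC X then q
      else if q = zero_AC X then p
      else \<Union>s\<in>p. \<Union>t\<in>q. AC_class X (s \<^bold>+ t))"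

definition mult_AC :: "'a set \<Rightarrow> 'a tm set \<Rightarrow> 'a tm set \<Rightarrow> 'a tm set" where
  "mult_AC X p q =
     (if p = zero_AC X \<or> q = zero_AC X then zero_AC X
      else if p = one_AC X then q
      else if q = one_AC X then p
      else \<Union>s\<in>p. \<Union>t\<in>q. AC_class X (s \<^bold>\<times> t))"

definition N_sb :: "'a set \<Rightarrow> 'a tm set ring" where
  "N_sb X = \<lparr>carrier = Nsb_carrier X, mult = mult_AC X, one = one_AC X,
             zero = zero_AC X, add = add_AC X\<rparr>"

text \<open>For a nonempty list, the trailing zero is absorbed by \<^const>\<open>add_AC\<close>.\<close>

definition sum_AC :: "'a set \<Rightarrow> 'a tm set list \<Rightarrow> 'a tm set" where
  "sum_AC X qs = foldr (add_AC X) qs (zero_AC X)"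


section \<open>Polynomials\<close>

inductive_set monomial_terms :: "'a set \<Rightarrow> 'a tm set" for X where
  "x \<in> X \<Longrightarrow> Var x \<in> monomial_terms X"
| "s \<in> monomial_terms X \<Longrightarrow> t \<in> monomial_terms X \<Longrightarrow> s \<^bold>\<times> t \<in> monomial_terms X"

inductive_set PT :: "'a set \<Rightarrow> 'a tm set" for X where
  zero: "Zero \<in> PT X"
| one: "One \<in> PT X"
| monomial: "t \<in> monomial_terms X \<Longrightarrow> t \<in> PT X"
| sum: "s \<in> PT X \<Longrightarrow> s \<noteq> Zero \<Longrightarrow> t \<in> PT X \<Longrightarrow> t \<noteq> Zero \<Longrightarrow> s \<^bold>+ t \<in> PT X"
| prod: "s \<in> monomial_terms X \<Longrightarrow> t \<in> PT X \<Longrightarrow> t \<noteq> Zero \<Longrightarrow> t \<noteq> One \<Longrightarrow> s \<^bold>\<times> t \<in> PT X"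

definition sum_polynomial_terms :: "'a set \<Rightarrow> 'a tm set" where
  "sum_polynomial_terms X = {s \<^bold>+ t | s t. s \<in> PT X - {Zero} \<and> t \<in> PT X - {Zero}}"

definition product_polynomial_terms :: "'a set \<Rightarrow> 'a tm set" where
  "product_polynomial_terms X =
     {s \<^bold>\<times> t | s t. s \<in> monomial_terms X \<and> t \<in> PT X - {Zero, One}}"

definition variable_classes :: "'a set \<Rightarrow> 'a tm set set" where
  "variable_classes X = {AC_class X (Var x) | x. x \<in> X}"

definition monomials :: "'a set \<Rightarrow> 'a tm set set" where
  "monomials X = AC_class X ` monomial_terms X"

definition polynomials :: "'a set \<Rightarrow> 'a tm set set" where
  "polynomials X = AC_class X ` PT X"

definition sum_polynomials :: "'a set \<Rightarrow> 'a tm set set" where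
  "sum_polynomials X = AC_class X ` sum_polynomial_terms X"

definition product_polynomials :: "'a set \<Rightarrow> 'a tm set set" where
  "product_polynomials X = AC_class X ` product_polynomial_terms X"

text \<open>The graph of the multiplication of polynomials. Its clauses are those of the recursion on the
  size of the left factor; a least relation needs no choice of a decomposition of that factor.
  The graph is single-valued because the decompositions are unique up to permutation of the
  summands.\<close>

inductive times_rd_graph :: "'a set \<Rightarrow> 'a tm set \<Rightarrow> 'a tm set \<Rightarrow> 'a tm set \<Rightarrow> bool" for X where
  zero_right: "q \<in> polynomials X \<Longrightarrow> times_rd_graph X q (zero_AC X) (zero_AC X)"
| zero_left: "q \<in> polynomials X \<Longrightarrow> times_rd_graph X (zero_AC X) q (zero_AC X)"
| one_right: "q \<in> polynomials X \<Longrightarrow> times_rd_graph X q (one_AC X) q"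
| one_left: "q \<in> polynomials X \<Longrightarrow> times_rd_graph X (one_AC X) q q"
| monomial: "q \<in> monomials X \<Longrightarrow> r \<in> polynomials X - {zero_AC X, one_AC X} \<Longrightarrow>
    times_rd_graph X q r (mult_AC X q r)"
| sum: "q \<in> sum_polynomials X \<Longrightarrow> r \<in> polynomials X - {zero_AC X, one_AC X} \<Longrightarrow>
    q = sum_AC X qs \<Longrightarrow> length qs \<ge> 2 \<Longrightarrow>
    set qs \<subseteq> product_polynomials X \<union> variable_classes X \<union> {one_AC X} \<Longrightarrow>
    list_all2 (\<lambda>q' p'. times_rd_graph X q' r p') qs ps \<Longrightarrow>
    times_rd_graph X q r (sum_AC X ps)"
| prod: "q = mult_AC X m q' \<Longrightarrow> r \<in> polynomials X - {zero_AC X, one_AC X} \<Longrightarrow>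
    m \<in> monomials X \<Longrightarrow> q' \<in> sum_polynomials X \<Longrightarrow>
    times_rd_graph X q' r p \<Longrightarrow>
    times_rd_graph X q r (mult_AC X m p)"

definition times_rd :: "'a set \<Rightarrow> 'a tm set \<Rightarrow> 'a tm set \<Rightarrow> 'a tm set" where
  "times_rd X q r = (THE p. times_rd_graph X q r p)"

definition N_rd :: "'a set \<Rightarrow> 'a tm set ring" where
  "N_rd X = \<lparr>carrier = polynomials X, mult = times_rd X, one = one_AC X,
             zero = zero_AC X, add = add_AC X\<rparr>"


section \<open>Id-reduced polynomials\<close>

definition sum_terms :: "'a set \<Rightarrow> 'a tm set" where
  "sum_terms X = {t \<in> ST X. \<exists>s1 s2. t = s1 \<^bold>+ s2 \<and> s1 \<in> ST X - {Zero} \<and> s2 \<in> ST X - {Zero}}"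

definition product_terms :: "'a set \<Rightarrow> 'a tm set" where
  "product_terms X =
     {t \<in> ST X. \<exists>s1 s2. t = s1 \<^bold>\<times> s2 \<and> s1 \<in> ST X - {Zero, One} \<and> s2 \<in> ST X - {Zero, One}}"

text \<open>\<open>bracketed_sum ts t\<close>: the term \<open>t\<close> is the sum of the list \<open>ts\<close>, in this order, with
  parentheses inserted in some way.\<close>

inductive bracketed_sum :: "'a tm list \<Rightarrow> 'a tm \<Rightarrow> bool" where
  "bracketed_sum [t] t"
| "bracketed_sum ss s \<Longrightarrow> bracketed_sum ts t \<Longrightarrow> bracketed_sum (ss @ ts) (s \<^bold>+ t)"

definition sum_product_decomposition :: "'a set \<Rightarrow> 'a tm \<Rightarrow> 'a tm list \<Rightarrow> bool" where
  "sum_product_decomposition X t ts \<longleftrightarrow>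
     length ts \<ge> 2 \<and> set ts \<subseteq> product_terms X \<union> Var ` X \<union> {One} \<and> bracketed_sum ts t"

inductive_set ST_id :: "'a set \<Rightarrow> 'a tm set" for X where
  zero: "Zero \<in> ST_id X"
| one: "One \<in> ST_id X"
| monomial: "t \<in> monomial_terms X \<Longrightarrow> t \<in> ST_id X"
| sum: "t \<in> sum_terms X \<Longrightarrow> sum_product_decomposition X t ts \<Longrightarrow>
    (\<And>i. i < length ts \<Longrightarrow> ts ! i \<in> ST_id X) \<Longrightarrow>
    (\<And>i j. i < j \<Longrightarrow> j < length ts \<Longrightarrow> (ts ! i, ts ! j) \<notin> eq_AC X) \<Longrightarrow>
    t \<in> ST_id X"
| prod: "s \<in> ST_id X \<Longrightarrow> s \<noteq> Zero \<Longrightarrow> s \<noteq> One \<Longrightarrow> t \<in> ST_id X \<Longrightarrow> t \<noteq> Zero \<Longrightarrow> t \<noteq> One \<Longrightarrow>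
    s \<^bold>\<times> t \<in> ST_id X"

definition PT_id :: "'a set \<Rightarrow> 'a tm set" where
  "PT_id X = PT X \<inter> ST_id X"

definition id_reduced_polynomials :: "'a set \<Rightarrow> 'a tm set set" where
  "id_reduced_polynomials X = AC_class X ` PT_id X"

definition id_decomposition :: "'a set \<Rightarrow> 'a tm set \<Rightarrow> 'a tm set list \<Rightarrow> bool" where
  "id_decomposition X q qs \<longleftrightarrow> qs \<noteq> [] \<and> q = sum_AC X qs \<and> distinct qs \<and>
     set qs \<subseteq> {one_AC X} \<union> monomials X \<union> (product_polynomials X \<inter> id_reduced_polynomials X)"

text \<open>The maximal set of indices \<open>j\<close> such that no \<open>rs ! j\<close> is a member of \<open>qs\<close> consists of all such
  \<open>j\<close>; hence the filter. The result does not depend on the order of \<open>qs\<close> and \<open>rs\<close>.\<close>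

definition add_id :: "'a set \<Rightarrow> 'a tm set \<Rightarrow> 'a tm set \<Rightarrow> 'a tm set" where
  "add_id X q r =
     (if q = zero_AC X then r
      else if r = zero_AC X then q
      else THE p. \<exists>qs rs. id_decomposition X q qs \<and> id_decomposition X r rs \<and>
                    p = sum_AC X (qs @ filter (\<lambda>r'. r' \<notin> set qs) rs))"

definition B_id_rd :: "'a set \<Rightarrow> 'a tm set ring" where
  "B_id_rd X = \<lparr>carrier = id_reduced_polynomials X, mult = times_rd X, one = one_AC X,
                zero = zero_AC X, add = add_id X\<rparr>"


text \<open>The inductive sets \<^const>\<open>PT\<close> and \<^const>\<open>ST_id\<close> do not require membership in
  \<^const>\<open>ST\<close> in their rules; they consist of simple terms nevertheless.\<close>

lemma self_in_subterms: "t \<in> subterms t"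
  by (cases t) auto

lemma ST_mul: "s \<in> ST X - {Zero, One} \<Longrightarrow> t \<in> ST X - {Zero, One} \<Longrightarrow> s \<^bold>\<times> t \<in> ST X"
  by (auto simp: ST_def T_def simple_def)

lemma ST_add: "s \<in> ST X - {Zero} \<Longrightarrow> t \<in> ST X - {Zero} \<Longrightarrow> s \<^bold>+ t \<in> ST X"
  by (auto simp: ST_def T_def simple_def)

lemma monomial_terms_ST: "t \<in> monomial_terms X \<Longrightarrow> t \<in> ST X - {Zero, One}"
proof (induction rule: monomial_terms.induct)
  case (1 x)
  then show ?case by (simp add: ST_def T_def simple_def)
next
  case (2 s t)
  then show ?case using ST_mul by blast
qed

lemma PT_subset_ST: "PT X \<subseteq> ST X"
proof
  fix t assume "t \<in> PT X"
  then show "t \<in> ST X"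
  proof (induction rule: PT.induct)
    case (sum s t)
    then show ?case using ST_add by blast
  next
    case (prod s t)
    then show ?case using ST_mul monomial_terms_ST by blast
  qed (use monomial_terms_ST in \<open>auto simp: ST_def T_def simple_def\<close>)
qed

lemma ST_id_subset_ST: "ST_id X \<subseteq> ST X"
proof
  fix t assume "t \<in> ST_id X"
  then show "t \<in> ST X"
  proof (induction rule: ST_id.induct)
    case (sum t ts)
    then show ?case by (simp add: sum_terms_def)
  next
    case (prod s t)
    then show ?case using ST_mul by blast
  qed (use monomial_terms_ST in \<open>auto simp: ST_def T_def simple_def\<close>)
qed

end

theory Submission
  imports Defs "HOL-Library.Multiset"
begin

text \<open>Each of the three algebras of classes is the image of the term algebra under an explicit
  homomorphism \<open>h\<close>. The isomorphism then amounts to two statements: \<open>h\<close> satisfies the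
  axioms (soundness), and terms with the same value are provably equal (completeness, because every
  term is provably equal to a normal form which depends on its value alone). The strong bimonoid
  axioms are inherited in the same way: on both sides every element is the value of a term, and
  the axioms are identities between values of terms.

  For the free strong bimonoid, \<open>h\<close> removes the superfluous occurrences of \<open>Zero\<close> and \<open>One\<close> from a
  term; the resulting simple term is its normal form up to AC-equality.

  For right-distributive terms, values are computed in a concrete model. Modulo right distributivity a
  term is a sum of summands, and each summand is either \<open>1\<close> or a variable times a nonzero term. Hence
  a polynomial is a finite multiset of summands, and a summand is \<open>Unit\<close> or \<open>Lead x p\<close> with a nonempty
  polynomial \<open>p\<close>. Multiplication from the right by a nonzero \<open>q\<close> acts on each summand separately and replaces
  every \<open>Unit\<close> at the end of a branch by \<open>q\<close>; associativity and right distributivity are immediate from this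
  description. Writing an element of the model as a term gives a bijection between the model and the
  AC-classes of polynomial terms (lemmas \<open>PT_ac_poly_term\<close> and \<open>expand_poly_term\<close>). Every rule of
  the inductive definition of \<open>\<times>\<^sub>r\<^sub>d\<close> is an identity of the model, so the bijection carries
  the multiplication of the model to \<open>\<times>\<^sub>r\<^sub>d\<close>. The uniqueness of decompositions is built
  into the model.

  In the idempotent case the values are the multisets in which no summand is repeated, hereditarily.
  The addition is the union of sets, while the multiplication stays the same: products of reduced
  polynomials are reduced, because distinct reduced summands have no common summand after
  multiplication by the same polynomial (lemma \<open>act_disjoint\<close>).\<close>

section \<open>Presenting a strong bimonoid by an evaluation of terms\<close>

lemma T_simps [simp]:
  "Var x \<in> T X \<longleftrightarrow> x \<in> X" "Zero \<in> T X" "One \<in> T X"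
  "s \<^bold>+ t \<in> T X \<longleftrightarrow> s \<in> T X \<and> t \<in> T X"
  "s \<^bold>\<times> t \<in> T X \<longleftrightarrow> s \<in> T X \<and> t \<in> T X"
  by (auto simp: T_def)

lemma term_congruenceD:
  assumes "term_congruence X R"
  shows "equiv (T X) R"
    and "t \<in> T X \<Longrightarrow> (t, t) \<in> R"
    and "(s, t) \<in> R \<Longrightarrow> (t, s) \<in> R"
    and "(s, t) \<in> R \<Longrightarrow> (t, u) \<in> R \<Longrightarrow> (s, u) \<in> R"
    and "(s, t) \<in> R \<Longrightarrow> s \<in> T X" "(s, t) \<in> R \<Longrightarrow> t \<in> T X"
    and "(s, s') \<in> R \<Longrightarrow> (t, t') \<in> R \<Longrightarrow> (s \<^bold>+ t, s' \<^bold>+ t') \<in> R"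
    and "(s, s') \<in> R \<Longrightarrow> (t, t') \<in> R \<Longrightarrow> (s \<^bold>\<times> t, s' \<^bold>\<times> t') \<in> R"
  using assms unfolding term_congruence_def equiv_def refl_on_def sym_def trans_def by blast+

lemma term_congruenceI:
  assumes "R \<subseteq> T X \<times> T X"
    and "\<And>t. t \<in> T X \<Longrightarrow> (t, t) \<in> R"
    and "\<And>s t. (s, t) \<in> R \<Longrightarrow> (t, s) \<in> R"
    and "\<And>s t u. (s, t) \<in> R \<Longrightarrow> (t, u) \<in> R \<Longrightarrow> (s, u) \<in> R"
    and "\<And>s s' t t'. (s, s') \<in> R \<Longrightarrow> (t, t') \<in> R \<Longrightarrow> (s \<^bold>+ t, s' \<^bold>+ t') \<in> R"
    and "\<And>s s' t t'. (s, s') \<in> R \<Longrightarrow> (t, t') \<in> R \<Longrightarrow> (s \<^bold>\<times> t, s' \<^bold>\<times> t') \<in> R"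
  shows "term_congruence X R"
  using assms unfolding term_congruence_def equiv_def refl_on_def sym_def trans_def by metis

lemma congruence_generated_by_subset:
  "term_congruence X R \<Longrightarrow> P \<subseteq> R \<Longrightarrow> congruence_generated_by X P \<subseteq> R"
  unfolding congruence_generated_by_def by blast

lemma generators_subset: "P \<subseteq> congruence_generated_by X P"
  unfolding congruence_generated_by_def by blast

lemma term_congruence_generated_by:
  assumes "P \<subseteq> T X \<times> T X"
  shows "term_congruence X (congruence_generated_by X P)"
proof (rule term_congruenceI)
  have "term_congruence X (T X \<times> T X)"
    by (rule term_congruenceI) auto
  with assms show "congruence_generated_by X P \<subseteq> T X \<times> T X"
    by (rule congruence_generated_by_subset[rotated])
qed (unfold congruence_generated_by_def, (blast dest: term_congruenceD)+)

lemma generating_pairs_subset: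
  "E_pairs X \<subseteq> T X \<times> T X" "rd_pairs X \<subseteq> T X \<times> T X" "id_pairs X \<subseteq> T X \<times> T X"
  by (auto simp: E_pairs_def rd_pairs_def id_pairs_def)

lemma E_pairsI:
  assumes "a \<in> T X" "b \<in> T X" "c \<in> T X"
  shows "(a \<^bold>+ (b \<^bold>+ c), (a \<^bold>+ b) \<^bold>+ c) \<in> E_pairs X" "(a \<^bold>+ b, b \<^bold>+ a) \<in> E_pairs X"
    "(a \<^bold>+ Zero, a) \<in> E_pairs X" "(a \<^bold>\<times> (b \<^bold>\<times> c), (a \<^bold>\<times> b) \<^bold>\<times> c) \<in> E_pairs X"
    "(One \<^bold>\<times> a, a) \<in> E_pairs X" "(a \<^bold>\<times> One, a) \<in> E_pairs X"
    "(a \<^bold>\<times> Zero, Zero) \<in> E_pairs X" "(Zero \<^bold>\<times> a, Zero) \<in> E_pairs X"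
  using assms unfolding E_pairs_def by blast+

text \<open>All axioms of strong bimonoids are identities, so they may be checked on terms as soon as
  every element of the algebra is the value of a term. This applies to the quotients of the term
  algebra and to the algebras of classes of simple terms alike.\<close>

locale evaluation =
  fixes X :: "'a set" and S :: "('b, 'm) ring_scheme" and h :: "'a tm \<Rightarrow> 'b"
  assumes carrier: "carrier S = h ` T X"
    and zero: "h Zero = \<zero>\<^bsub>S\<^esub>"
    and one: "h One = \<one>\<^bsub>S\<^esub>"
    and add: "s \<in> T X \<Longrightarrow> t \<in> T X \<Longrightarrow> h (s \<^bold>+ t) = h s \<oplus>\<^bsub>S\<^esub> h t"
    and mult: "s \<in> T X \<Longrightarrow> t \<in> T X \<Longrightarrow> h (s \<^bold>\<times> t) = h s \<otimes>\<^bsub>S\<^esub> h t"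

text \<open>For a congruence, the unions over all representatives in the quotient operations are single
  classes, so the canonical projection is a homomorphism.\<close>

lemma evaluation_quotient:
  assumes R: "term_congruence X R"
  shows "evaluation X (quotient_algebra X R) (\<lambda>t. R `` {t})"
proof -
  note R_simps = term_congruenceD[OF R]
  have eq: "R `` {s} = R `` {t}" if "(s, t) \<in> R" for s t
    using R_simps(1) that by (rule equiv_class_eq)
  have op: "(\<Union>s'\<in>R `` {s}. \<Union>t'\<in>R `` {t}. R `` {f s' t'}) = R `` {f s t}"
    if f: "\<And>s s' t t'. (s, s') \<in> R \<Longrightarrow> (t, t') \<in> R \<Longrightarrow> (f s t, f s' t') \<in> R"
      and "s \<in> T X" "t \<in> T X" for f s t
  proof -
    have "R `` {f s' t'} = R `` {f s t}" if "s' \<in> R `` {s}" "t' \<in> R `` {t}" for s' t'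
      using that by (auto intro!: eq f intro: R_simps(3))
    moreover have "s \<in> R `` {s}" "t \<in> R `` {t}"
      using that R_simps(2) by auto
    ultimately show ?thesis by blast
  qed
  show ?thesis
    by unfold_locales
      (auto simp: quotient_algebra_def quotient_def op[where f = "(\<^bold>+)", OF R_simps(7)]
        op[where f = "(\<^bold>\<times>)", OF R_simps(8)])
qed

context evaluation
begin

lemma strong_bimonoid:
  assumes sound: "\<And>s t. (s, t) \<in> E_pairs X \<Longrightarrow> h s = h t"
  shows "strong_bimonoid S"
proof -
  have identities:
    "h a \<oplus>\<^bsub>S\<^esub> (h b \<oplus>\<^bsub>S\<^esub> h c) = (h a \<oplus>\<^bsub>S\<^esub> h b) \<oplus>\<^bsub>S\<^esub> h c" "h a \<oplus>\<^bsub>S\<^esub> h b = h b \<oplus>\<^bsub>S\<^esub> h a"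
    "h a \<oplus>\<^bsub>S\<^esub> \<zero>\<^bsub>S\<^esub> = h a"
    "h a \<otimes>\<^bsub>S\<^esub> (h b \<otimes>\<^bsub>S\<^esub> h c) = (h a \<otimes>\<^bsub>S\<^esub> h b) \<otimes>\<^bsub>S\<^esub> h c"
    "\<one>\<^bsub>S\<^esub> \<otimes>\<^bsub>S\<^esub> h a = h a" "h a \<otimes>\<^bsub>S\<^esub> \<one>\<^bsub>S\<^esub> = h a"
    "h a \<otimes>\<^bsub>S\<^esub> \<zero>\<^bsub>S\<^esub> = \<zero>\<^bsub>S\<^esub>" "\<zero>\<^bsub>S\<^esub> \<otimes>\<^bsub>S\<^esub> h a = \<zero>\<^bsub>S\<^esub>"
    if "a \<in> T X" "b \<in> T X" "c \<in> T X" for a b c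
    using E_pairsI[OF that, THEN sound] that by (simp_all add: add mult zero one)
  have closed: "h a \<oplus>\<^bsub>S\<^esub> h b \<in> carrier S" "h a \<otimes>\<^bsub>S\<^esub> h b \<in> carrier S"
    if "a \<in> T X" "b \<in> T X" for a b
    using that imageI[of "a \<^bold>+ b" "T X" h] imageI[of "a \<^bold>\<times> b" "T X" h]
    by (simp_all add: carrier add mult)
  have constants: "\<zero>\<^bsub>S\<^esub> \<in> carrier S" "\<one>\<^bsub>S\<^esub> \<in> carrier S"
    by (auto simp: carrier zero[symmetric] one[symmetric])
  have zero_add: "\<zero>\<^bsub>S\<^esub> \<oplus>\<^bsub>S\<^esub> h a = h a" if "a \<in> T X" for a
    using identities(2)[OF that T_simps(2) that] identities(3)[OF that that that]
    by (simp add: zero)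
  show ?thesis
    by unfold_locales
      (auto simp: carrier identities zero_add closed[unfolded carrier] constants[unfolded carrier]
        identities(2) intro: identities)
qed

lemma term_congruence_kernel: "term_congruence X {(s, t). s \<in> T X \<and> t \<in> T X \<and> h s = h t}"
  by (rule term_congruenceI) (auto simp: add mult)

lemma bimonoid_iso_quotient:
  assumes kernel: "R = {(s, t). s \<in> T X \<and> t \<in> T X \<and> h s = h t}"
  shows "quotient_algebra X R \<cong>\<^sub>s\<^sub>b S"
proof -
  have R: "term_congruence X R"
    unfolding kernel by (rule term_congruence_kernel)
  interpret Q: evaluation X "quotient_algebra X R" "\<lambda>t. R `` {t}"
    by (rule evaluation_quotient[OF R])
  let ?f = "\<lambda>A. the_elem (h ` A)"
  have f: "?f (R `` {t}) = h t" if "t \<in> T X" for t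
  proof -
    have "h ` (R `` {t}) = {h t}"
      using that by (auto simp: kernel)
    then show ?thesis by simp
  qed
  have "?f \<in> ring_hom (quotient_algebra X R) S"
  proof (rule ring_hom_memI)
    fix A B assume AB: "A \<in> carrier (quotient_algebra X R)" "B \<in> carrier (quotient_algebra X R)"
    then obtain s t where st: "s \<in> T X" "t \<in> T X" "A = R `` {s}" "B = R `` {t}"
      by (auto simp: Q.carrier)
    show "?f (A \<otimes>\<^bsub>quotient_algebra X R\<^esub> B) = ?f A \<otimes>\<^bsub>S\<^esub> ?f B"
      using st by (simp add: Q.mult[symmetric] f mult)
    show "?f (A \<oplus>\<^bsub>quotient_algebra X R\<^esub> B) = ?f A \<oplus>\<^bsub>S\<^esub> ?f B"
      using st by (simp add: Q.add[symmetric] f add)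
  next
    fix A assume "A \<in> carrier (quotient_algebra X R)"
    then show "?f A \<in> carrier S"
      by (auto simp: Q.carrier carrier f)
  next
    show "?f \<one>\<^bsub>quotient_algebra X R\<^esub> = \<one>\<^bsub>S\<^esub>"
      by (simp add: Q.one[symmetric] f one)
  qed
  moreover have "bij_betw ?f (carrier (quotient_algebra X R)) (carrier S)"
  proof -
    have "inj_on ?f (carrier (quotient_algebra X R))"
    proof (rule inj_onI)
      fix A B assume AB: "A \<in> carrier (quotient_algebra X R)"
        "B \<in> carrier (quotient_algebra X R)" "?f A = ?f B"
      then obtain s t where st: "s \<in> T X" "t \<in> T X" "A = R `` {s}" "B = R `` {t}"
        by (auto simp: Q.carrier)
      with AB(3) have "h s = h t" by (simp add: f)
      with st show "A = B" by (auto simp: kernel)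
    qed
    moreover have "?f ` carrier (quotient_algebra X R) = carrier S"
      by (auto simp: Q.carrier carrier f image_image)
    ultimately show ?thesis by (simp add: bij_betw_def)
  qed
  moreover have "?f \<zero>\<^bsub>quotient_algebra X R\<^esub> = \<zero>\<^bsub>S\<^esub>"
    by (simp add: Q.zero[symmetric] f zero)
  ultimately show ?thesis
    unfolding isomorphic_bimonoids_def bimonoid_iso_def ring_iso_def by blast
qed

text \<open>The kernel of \<open>h\<close> is a congruence, so soundness on the generating pairs already bounds the
  generated congruence by it; completeness gives the converse inclusion.\<close>

lemma presentation:
  assumes "P \<subseteq> T X \<times> T X" "E_pairs X \<subseteq> P"
    and sound: "\<And>s t. (s, t) \<in> P \<Longrightarrow> h s = h t"
    and complete: "\<And>s t. s \<in> T X \<Longrightarrow> t \<in> T X \<Longrightarrow> h s = h t \<Longrightarrow>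
      (s, t) \<in> congruence_generated_by X P"
  shows "strong_bimonoid (quotient_algebra X (congruence_generated_by X P)) \<and>
    strong_bimonoid S \<and> quotient_algebra X (congruence_generated_by X P) \<cong>\<^sub>s\<^sub>b S"
proof (intro conjI)
  let ?R = "congruence_generated_by X P"
  have R: "term_congruence X ?R"
    using assms(1) by (rule term_congruence_generated_by)
  interpret Q: evaluation X "quotient_algebra X ?R" "\<lambda>t. ?R `` {t}"
    by (rule evaluation_quotient[OF R])
  show "strong_bimonoid (quotient_algebra X ?R)"
  proof (rule Q.strong_bimonoid)
    fix s t assume "(s, t) \<in> E_pairs X"
    then have "(s, t) \<in> ?R" using assms(2) generators_subset by blast
    then show "?R `` {s} = ?R `` {t}"
      using term_congruenceD(1)[OF R] by (rule equiv_class_eq[rotated])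
  qed
  show "strong_bimonoid S"
    using assms(2) sound by (blast intro: strong_bimonoid)
  show "quotient_algebra X ?R \<cong>\<^sub>s\<^sub>b S"
  proof (rule bimonoid_iso_quotient, rule equalityI)
    show "?R \<subseteq> {(s, t). s \<in> T X \<and> t \<in> T X \<and> h s = h t}"
      using assms(1) sound by (intro congruence_generated_by_subset term_congruence_kernel) auto
    show "{(s, t). s \<in> T X \<and> t \<in> T X \<and> h s = h t} \<subseteq> ?R"
      using complete by auto
  qed
qed

end

section \<open>Simple terms modulo associativity and commutativity\<close>

abbreviation ac_equal :: "'a tm \<Rightarrow> 'a tm \<Rightarrow> bool" (infix \<open>\<approx>\<close> 50) where
  "s \<approx> t \<equiv> ac_step\<^sup>*\<^sup>* s t"

lemma ac_step_sym: "ac_step s t \<Longrightarrow> ac_step t s"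
  by (induction rule: ac_step.induct) (auto intro: ac_step.intros)

lemma ac_sym: "s \<approx> t \<Longrightarrow> t \<approx> s"
  by (induction rule: rtranclp_induct) (auto intro: ac_step_sym converse_rtranclp_into_rtranclp)

lemma ac_add: "s \<approx> s' \<Longrightarrow> t \<approx> t' \<Longrightarrow> s \<^bold>+ t \<approx> s' \<^bold>+ t'"
proof -
  have "s \<^bold>+ t \<approx> s' \<^bold>+ t" if "s \<approx> s'"
    using that by induction (auto intro: ac_step.add_left rtranclp.rtrancl_into_rtrancl)
  moreover have "s' \<^bold>+ t \<approx> s' \<^bold>+ t'" if "t \<approx> t'"
    using that by induction (auto intro: ac_step.add_right rtranclp.rtrancl_into_rtrancl)
  ultimately show "s \<approx> s' \<Longrightarrow> t \<approx> t' \<Longrightarrow> s \<^bold>+ t \<approx> s' \<^bold>+ t'"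
    by (meson rtranclp_trans)
qed

lemma ac_mul: "s \<approx> s' \<Longrightarrow> t \<approx> t' \<Longrightarrow> s \<^bold>\<times> t \<approx> s' \<^bold>\<times> t'"
proof -
  have "s \<^bold>\<times> t \<approx> s' \<^bold>\<times> t" if "s \<approx> s'"
    using that by induction (auto intro: ac_step.mul_left rtranclp.rtrancl_into_rtrancl)
  moreover have "s' \<^bold>\<times> t \<approx> s' \<^bold>\<times> t'" if "t \<approx> t'"
    using that by induction (auto intro: ac_step.mul_right rtranclp.rtrancl_into_rtrancl)
  ultimately show "s \<approx> s' \<Longrightarrow> t \<approx> t' \<Longrightarrow> s \<^bold>\<times> t \<approx> s' \<^bold>\<times> t'"
    by (meson rtranclp_trans)
qed

lemma no_ac_step_constants: "\<not> ac_step Zero t" "\<not> ac_step One t"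
  by (auto elim: ac_step.cases)

lemma ac_constants_iff [simp]:
  "Zero \<approx> t \<longleftrightarrow> t = Zero" "One \<approx> t \<longleftrightarrow> t = One" "t \<approx> Zero \<longleftrightarrow> t = Zero" "t \<approx> One \<longleftrightarrow> t = One"
proof -
  show "Zero \<approx> t \<longleftrightarrow> t = Zero" for t :: "'a tm"
    by (auto elim: converse_rtranclpE simp: no_ac_step_constants)
  then show "t \<approx> Zero \<longleftrightarrow> t = Zero"
    using ac_sym by blast
  show "One \<approx> t \<longleftrightarrow> t = One" for t :: "'a tm"
    by (auto elim: converse_rtranclpE simp: no_ac_step_constants)
  then show "t \<approx> One \<longleftrightarrow> t = One"
    using ac_sym by blast
qed

text \<open>The operations of the algebra of simple terms on representatives: they insert a symbol only
  where the result stays simple.\<close>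

definition simple_add :: "'a tm \<Rightarrow> 'a tm \<Rightarrow> 'a tm" where
  "simple_add s t = (if s = Zero then t else if t = Zero then s else s \<^bold>+ t)"

definition simple_mul :: "'a tm \<Rightarrow> 'a tm \<Rightarrow> 'a tm" where
  "simple_mul s t =
     (if s = Zero \<or> t = Zero then Zero else if s = One then t else if t = One then s else s \<^bold>\<times> t)"

lemma simple_add_ac_cong: "s \<approx> s' \<Longrightarrow> t \<approx> t' \<Longrightarrow> simple_add s t \<approx> simple_add s' t'"
  by (auto simp: simple_add_def ac_add)

lemma simple_mul_ac_cong: "s \<approx> s' \<Longrightarrow> t \<approx> t' \<Longrightarrow> simple_mul s t \<approx> simple_mul s' t'"
  by (auto simp: simple_mul_def ac_mul)

lemma simple_add_assoc: "simple_add s (simple_add t u) \<approx> simple_add (simple_add s t) u"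
  by (auto simp: simple_add_def intro: ac_step.intros)

lemma simple_add_commute: "simple_add s t \<approx> simple_add t s"
  by (auto simp: simple_add_def intro: ac_step.intros)

lemma simple_mul_assoc: "simple_mul s (simple_mul t u) \<approx> simple_mul (simple_mul s t) u"
  by (auto simp: simple_mul_def intro: ac_step.intros)

lemma simple_op_units [simp]:
  "simple_add Zero t = t" "simple_add t Zero = t"
  "simple_mul Zero t = Zero" "simple_mul t Zero = Zero"
  "simple_mul One t = t" "simple_mul t One = t"
  by (auto simp: simple_add_def simple_mul_def)

lemma simple_op_eq_Zero_iff [simp]:
  "simple_add s t = Zero \<longleftrightarrow> s = Zero \<and> t = Zero"
  "simple_mul s t = Zero \<longleftrightarrow> s = Zero \<or> t = Zero"
  by (auto simp: simple_add_def simple_mul_def)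

lemma ST_constants [simp]: "Zero \<in> ST X" "One \<in> ST X"
  by (auto simp: ST_def simple_def)

lemma ST_Var [simp]: "x \<in> X \<Longrightarrow> Var x \<in> ST X"
  by (auto simp: ST_def simple_def)

lemma simple_op_in_ST:
  "s \<in> ST X \<Longrightarrow> t \<in> ST X \<Longrightarrow> simple_add s t \<in> ST X"
  "s \<in> ST X \<Longrightarrow> t \<in> ST X \<Longrightarrow> simple_mul s t \<in> ST X"
  by (auto simp: simple_add_def simple_mul_def intro!: ST_add ST_mul)

lemma AC_class_eq_iff:
  assumes "s \<in> ST X" "t \<in> ST X"
  shows "AC_class X s = AC_class X t \<longleftrightarrow> s \<approx> t"
proof
  assume "AC_class X s = AC_class X t"
  moreover have "t \<in> AC_class X t"
    using assms by (simp add: AC_class_def eq_AC_def)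
  ultimately show "s \<approx> t"
    by (auto simp: AC_class_def eq_AC_def)
next
  assume st: "s \<approx> t"
  then have "t \<approx> s" by (rule ac_sym)
  with st assms show "AC_class X s = AC_class X t"
    by (auto simp: AC_class_def eq_AC_def intro: rtranclp_trans)
qed

lemma in_AC_class_iff: "t \<in> AC_class X s \<longleftrightarrow> s \<in> ST X \<and> t \<in> ST X \<and> s \<approx> t"
  by (auto simp: AC_class_def eq_AC_def)

lemma AC_class_eq_constant_iff [simp]:
  assumes "t \<in> ST X"
  shows "AC_class X t = zero_AC X \<longleftrightarrow> t = Zero" "AC_class X t = one_AC X \<longleftrightarrow> t = One"
  using assms by (simp_all add: zero_AC_def one_AC_def AC_class_eq_iff)

text \<open>An operation on terms that respects AC-equality induces one on classes, in the form in which
  the operations on classes are defined.\<close>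

lemma AC_class_UN:
  assumes "s \<in> ST X" "t \<in> ST X" "f s t \<in> ST X"
    and "\<And>s' t'. s' \<in> ST X \<Longrightarrow> t' \<in> ST X \<Longrightarrow> s \<approx> s' \<Longrightarrow> t \<approx> t' \<Longrightarrow>
      f s' t' \<in> ST X \<and> f s t \<approx> f s' t'"
  shows "(\<Union>s'\<in>AC_class X s. \<Union>t'\<in>AC_class X t. AC_class X (f s' t')) = AC_class X (f s t)"
proof -
  have "AC_class X (f s' t') = AC_class X (f s t)"
    if "s' \<in> AC_class X s" "t' \<in> AC_class X t" for s' t'
    using that assms by (metis AC_class_eq_iff in_AC_class_iff)
  moreover have "s \<in> AC_class X s" "t \<in> AC_class X t"
    using assms by (simp_all add: in_AC_class_iff)
  ultimately show ?thesis by blast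
qed

lemma add_AC_class:
  assumes "s \<in> ST X" "t \<in> ST X"
  shows "add_AC X (AC_class X s) (AC_class X t) = AC_class X (simple_add s t)"
proof (cases "s = Zero \<or> t = Zero")
  case True
  then show ?thesis
    using assms by (auto simp: add_AC_def)
next
  case False
  then have "(\<Union>s'\<in>AC_class X s. \<Union>t'\<in>AC_class X t. AC_class X (s' \<^bold>+ t')) = AC_class X (s \<^bold>+ t)"
    using assms by (intro AC_class_UN) (auto intro!: ST_add ac_add)
  then show ?thesis
    using False assms by (simp add: add_AC_def simple_add_def)
qed

lemma mult_AC_class:
  assumes "s \<in> ST X" "t \<in> ST X"
  shows "mult_AC X (AC_class X s) (AC_class X t) = AC_class X (simple_mul s t)"
proof (cases "s \<in> {Zero, One} \<or> t \<in> {Zero, One}")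
  case True
  then show ?thesis
    using assms by (auto simp: mult_AC_def zero_AC_def one_AC_def AC_class_eq_iff)
next
  case False
  then have "(\<Union>s'\<in>AC_class X s. \<Union>t'\<in>AC_class X t. AC_class X (s' \<^bold>\<times> t')) = AC_class X (s \<^bold>\<times> t)"
    using assms by (intro AC_class_UN) (auto intro!: ST_mul ac_mul)
  then show ?thesis
    using False assms by (simp add: mult_AC_def simple_mul_def)
qed

text \<open>Inside a congruence containing the axioms of strong bimonoids, the simple operations are
  indistinguishable from the symbols \<open>\<^bold>+\<close> and \<open>\<^bold>\<times>\<close>, and AC-equality is respected.\<close>

locale bimonoid_congruence =
  fixes X :: "'a set" and R :: "('a tm \<times> 'a tm) set"
  assumes congruence: "term_congruence X R" and E_pairs: "E_pairs X \<subseteq> R"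
begin

lemmas refl = term_congruenceD(2)[OF congruence]
  and sym = term_congruenceD(3)[OF congruence]
  and trans = term_congruenceD(4)[OF congruence]
  and in_T = term_congruenceD(5,6)[OF congruence]
  and add = term_congruenceD(7)[OF congruence]
  and mul = term_congruenceD(8)[OF congruence]
  and axioms = E_pairsI[where X = X, THEN subsetD[OF E_pairs]]

lemma Zero_add: "a \<in> T X \<Longrightarrow> (Zero \<^bold>+ a, a) \<in> R"
  using axioms(2)[of Zero a a] axioms(3)[of a a a] trans by auto

lemma simple_add_eq: "s \<in> T X \<Longrightarrow> t \<in> T X \<Longrightarrow> (simple_add s t, s \<^bold>+ t) \<in> R"
  by (auto simp: simple_add_def intro!: refl intro: sym Zero_add axioms)

lemma simple_mul_eq: "s \<in> T X \<Longrightarrow> t \<in> T X \<Longrightarrow> (simple_mul s t, s \<^bold>\<times> t) \<in> R"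
  by (auto simp: simple_mul_def intro!: refl intro: sym axioms)

lemma ac_step_eq: "ac_step s t \<Longrightarrow> s \<in> T X \<Longrightarrow> (s, t) \<in> R"
  by (induction rule: ac_step.induct) (auto intro: axioms sym add mul refl)

lemma ac_eq: "s \<approx> t \<Longrightarrow> s \<in> T X \<Longrightarrow> (s, t) \<in> R"
  by (induction rule: rtranclp_induct) (auto intro: refl trans ac_step_eq dest: in_T)

end

lemma bimonoid_congruence_generated_by:
  assumes "P \<subseteq> T X \<times> T X" "E_pairs X \<subseteq> P"
  shows "bimonoid_congruence X (congruence_generated_by X P)"
  using term_congruence_generated_by[OF assms(1)] assms(2) generators_subset
  by unfold_locales blast+


section \<open>The free strong bimonoid\<close>

primrec simplify :: "'a tm \<Rightarrow> 'a tm" where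
  "simplify (Var x) = Var x"
| "simplify Zero = Zero"
| "simplify One = One"
| "simplify (s \<^bold>+ t) = simple_add (simplify s) (simplify t)"
| "simplify (s \<^bold>\<times> t) = simple_mul (simplify s) (simplify t)"

lemma simplify_in_ST: "t \<in> T X \<Longrightarrow> simplify t \<in> ST X"
  by (induction t) (auto intro: simple_op_in_ST)

lemma ST_subset_T: "ST X \<subseteq> T X"
  by (auto simp: ST_def)

lemma simple_subterm:
  assumes "simple (s \<^bold>+ t) \<or> simple (s \<^bold>\<times> t)"
  shows "simple s" "simple t" "s \<noteq> Zero" "t \<noteq> Zero"
  using assms self_in_subterms[of s] self_in_subterms[of t] by (auto simp: simple_def)

lemma simplify_simple: "simple t \<Longrightarrow> simplify t = t"
proof (induction t)
  case (Add s t)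
  then show ?case
    using simple_subterm[of s t] by (auto simp: simple_add_def)
next
  case (Mul s t)
  have "s \<noteq> One" "t \<noteq> One"
    using Mul.prems by (auto simp: simple_def)
  with Mul show ?case
    using simple_subterm[of s t] by (auto simp: simple_mul_def)
qed auto

lemma (in bimonoid_congruence) simplify_eq: "t \<in> T X \<Longrightarrow> (t, simplify t) \<in> R"
proof (induction t)
  case (Add s t)
  then have "(simple_add (simplify s) (simplify t), simplify s \<^bold>+ simplify t) \<in> R"
    using in_T by (auto intro: simple_add_eq)
  with Add show ?case by (auto intro: trans add sym)
next
  case (Mul s t)
  then have "(simple_mul (simplify s) (simplify t), simplify s \<^bold>\<times> simplify t) \<in> R"
    using in_T by (auto intro: simple_mul_eq)
  with Mul show ?case by (auto intro: trans mul sym)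
qed (auto intro: refl)

text \<open>Only associativity and commutativity survive simplification as proper AC-steps; the axioms for
  the two constants become trivial.\<close>

lemma simplify_E_pairs: "(s, t) \<in> E_pairs X \<Longrightarrow> simplify s \<approx> simplify t"
  by (auto simp: E_pairs_def intro: simple_add_assoc simple_add_commute simple_mul_assoc)

lemma evaluation_N_sb: "evaluation X (N_sb X) (\<lambda>t. AC_class X (simplify t))"
proof
  have "AC_class X ` ST X \<subseteq> (\<lambda>t. AC_class X (simplify t)) ` T X"
  proof clarify
    fix s assume "s \<in> ST X"
    then show "AC_class X s \<in> (\<lambda>t. AC_class X (simplify t)) ` T X"
      by (intro image_eqI[of _ _ s]) (auto simp: ST_def simplify_simple)
  qed
  then show "carrier (N_sb X) = (\<lambda>t. AC_class X (simplify t)) ` T X"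
    by (auto simp: N_sb_def Nsb_carrier_def quotient_def AC_class_def[symmetric]
        intro: simplify_in_ST)
qed (auto simp: N_sb_def zero_AC_def one_AC_def simplify_in_ST add_AC_class mult_AC_class)

theorem free_strong_bimonoid:
  "strong_bimonoid (FB X) \<and> strong_bimonoid (N_sb X) \<and> FB X \<cong>\<^sub>s\<^sub>b N_sb X"
proof -
  interpret evaluation X "N_sb X" "\<lambda>t. AC_class X (simplify t)"
    by (rule evaluation_N_sb)
  interpret R: bimonoid_congruence X "eq_E X"
    unfolding eq_E_def using generating_pairs_subset(1)
    by (rule bimonoid_congruence_generated_by) simp
  show ?thesis
    unfolding FB_def eq_E_def
  proof (rule presentation)
    show "AC_class X (simplify s) = AC_class X (simplify t)" if "(s, t) \<in> E_pairs X" for s t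
      using that generating_pairs_subset(1) simplify_E_pairs
      by (subst AC_class_eq_iff) (auto intro: simplify_in_ST)
    show "(s, t) \<in> congruence_generated_by X (E_pairs X)"
      if st: "s \<in> T X" "t \<in> T X" and eq: "AC_class X (simplify s) = AC_class X (simplify t)" for s t
    proof -
      have "simplify s \<approx> simplify t"
        using eq st by (simp add: AC_class_eq_iff simplify_in_ST)
      then have "(simplify s, simplify t) \<in> eq_E X"
        using st simplify_in_ST ST_subset_T by (blast intro: R.ac_eq)
      with st show ?thesis
        unfolding eq_E_def[symmetric] by (blast intro: R.trans R.sym R.simplify_eq)
    qed
  qed (use generating_pairs_subset(1) in auto)
qed

section \<open>A model of right-distributive terms\<close>

text \<open>\<open>Lead x p\<close> stands for the product of the variable \<open>x\<close> with the sum of \<open>p\<close>. Products with a longer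
  monomial are nested; thus the word \<open>x y\<close> is \<open>Lead x {#Lead y {#Unit#}#}\<close>. One variable at a time
  makes the representation unique without a separate maximality condition on the monomial. Tails
  should be nonempty, because a variable times zero is zero; this is imposed by \<open>summands\<close> below.\<close>

datatype 'a summand = Unit | Lead 'a "'a summand multiset"

text \<open>\<open>act q s\<close> is the product \<open>s q\<close>. It vanishes for \<open>q = {#}\<close>, where the second equation would otherwise
  produce an empty tail.\<close>

primrec act :: "'a summand multiset \<Rightarrow> 'a summand \<Rightarrow> 'a summand multiset" where
  "act q Unit = q"
| "act q (Lead x p) = (if q = {#} then {#} else {#Lead x (\<Sum>\<^sub># (image_mset (act q) p))#})"

definition mul :: "'a summand multiset \<Rightarrow> 'a summand multiset \<Rightarrow> 'a summand multiset" where
  "mul p q = (\<Sum>s\<in>#p. act q s)"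

lemma act_Lead: "q \<noteq> {#} \<Longrightarrow> act q (Lead x p) = {#Lead x (mul p q)#}"
  by (simp add: mul_def)

declare act.simps(2) [simp del]

lemma act_zero [simp]: "act {#} s = {#}"
  by (cases s) (simp_all add: act.simps(2))

lemma mul_simps [simp]:
  "mul {#} q = {#}" "mul {#s#} q = act q s" "mul (p + p') q = mul p q + mul p' q"
  "mul (add_mset s p) q = act q s + mul p q"
  by (simp_all add: mul_def)

lemma mul_zero [simp]: "mul p {#} = {#}"
  by (induction p) auto

lemma act_eq_empty_iff [simp]: "act q s = {#} \<longleftrightarrow> q = {#}"
  by (cases s) (auto simp: act.simps(2))

lemma mul_eq_empty_iff [simp]: "mul p q = {#} \<longleftrightarrow> p = {#} \<or> q = {#}"
  by (induction p) auto

lemma in_mul_iff: "e \<in># mul p q \<longleftrightarrow> (\<exists>s. s \<in># p \<and> e \<in># act q s)"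
  by (induction p) auto

lemma mul_sum: "mul (\<Sum>s\<in>#p. f s) r = (\<Sum>s\<in>#p. mul (f s) r)"
  by (induction p) auto

lemma act_one: "act {#Unit#} s = {#s#}"
proof (induction s)
  case (Lead x p)
  then have "mul p {#Unit#} = (\<Sum>s\<in>#p. {#s#})"
    unfolding mul_def by (intro arg_cong[where f = sum_mset] image_mset_cong)
  then show ?case by (simp add: act_Lead)
qed auto

lemma mul_one [simp]: "mul p {#Unit#} = p"
  by (simp add: mul_def act_one)

text \<open>Associativity. Multiplying twice replaces each final \<open>Unit\<close> by \<open>q\<close> and then each final \<open>Unit\<close>
  of that copy of \<open>q\<close> by \<open>r\<close>.\<close>

lemma mul_act: "mul (act q s) r = act (mul q r) s"
proof (induction s)
  case (Lead x p)
  show ?case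
  proof (cases "q = {#} \<or> r = {#}")
    case False
    have "mul (mul p q) r = (\<Sum>s\<in>#p. mul (act q s) r)"
      by (simp add: mul_def[of p] mul_sum)
    also have "\<dots> = mul p (mul q r)"
      unfolding mul_def[of p] using Lead by (intro arg_cong[where f = sum_mset] image_mset_cong)
    finally show ?thesis
      using False by (simp add: act_Lead)
  qed auto
qed auto

lemma mul_assoc: "mul (mul p q) r = mul p (mul q r)"
  by (simp add: mul_def[of p] mul_sum mul_act)

inductive_set summands :: "'a set \<Rightarrow> 'a summand set" for X where
  Unit: "Unit \<in> summands X"
| Lead: "x \<in> X \<Longrightarrow> p \<noteq> {#} \<Longrightarrow> (\<And>s. s \<in># p \<Longrightarrow> s \<in> summands X) \<Longrightarrow> Lead x p \<in> summands X"

definition polys :: "'a set \<Rightarrow> 'a summand multiset set" where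
  "polys X = {p. set_mset p \<subseteq> summands X}"

lemma polys_simps [simp]:
  "{#} \<in> polys X" "add_mset s p \<in> polys X \<longleftrightarrow> s \<in> summands X \<and> p \<in> polys X"
  "p + q \<in> polys X \<longleftrightarrow> p \<in> polys X \<and> q \<in> polys X"
  by (auto simp: polys_def)

lemma Unit_in_summands [simp]: "Unit \<in> summands X"
  by (rule summands.Unit)

lemma Lead_in_summands [simp]:
  "Lead x p \<in> summands X \<longleftrightarrow> x \<in> X \<and> p \<noteq> {#} \<and> p \<in> polys X"
  by (auto simp: polys_def intro: summands.Lead elim: summands.cases)

lemma act_in_polys: "s \<in> summands X \<Longrightarrow> q \<in> polys X \<Longrightarrow> act q s \<in> polys X"
proof (induction rule: summands.induct)
  case (Lead x p)
  then have "mul p q \<in> polys X"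
    by (fastforce simp: polys_def in_mul_iff)
  with Lead show ?case
    by (cases "q = {#}") (auto simp: act_Lead)
qed auto

lemma mul_in_polys: "p \<in> polys X \<Longrightarrow> q \<in> polys X \<Longrightarrow> mul p q \<in> polys X"
  by (induction p) (auto intro: act_in_polys)

text \<open>\<open>Unit\<close> has weight one, so that a single summand of a longer sum is always lighter than the
  sum.\<close>

primrec weight :: "'a summand \<Rightarrow> nat" where
  "weight Unit = 1"
| "weight (Lead x p) = Suc (\<Sum>\<^sub># (image_mset weight p))"

abbreviation total_weight :: "'a summand multiset \<Rightarrow> nat" where
  "total_weight p \<equiv> (\<Sum>s\<in>#p. weight s)"

lemma weight_pos: "weight s > 0"
  by (cases s) auto

primrec expand :: "'a tm \<Rightarrow> 'a summand multiset" where
  "expand (Var x) = {#Lead x {#Unit#}#}"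
| "expand Zero = {#}"
| "expand One = {#Unit#}"
| "expand (s \<^bold>+ t) = expand s + expand t"
| "expand (s \<^bold>\<times> t) = mul (expand s) (expand t)"

lemma expand_in_polys: "t \<in> T X \<Longrightarrow> expand t \<in> polys X"
  by (induction t) (auto intro: mul_in_polys)

lemma expand_E_rd_pairs: "(s, t) \<in> E_pairs X \<union> rd_pairs X \<Longrightarrow> expand s = expand t"
  by (auto simp: E_pairs_def rd_pairs_def mul_assoc)

lemma expand_ac_step: "ac_step s t \<Longrightarrow> expand s = expand t"
  by (induction rule: ac_step.induct) (auto simp: mul_assoc)

lemma expand_ac: "s \<approx> t \<Longrightarrow> expand s = expand t"
  by (induction rule: rtranclp_induct) (auto dest: expand_ac_step)

lemma expand_simple_op [simp]:
  "expand (simple_add s t) = expand s + expand t"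
  "expand (simple_mul s t) = mul (expand s) (expand t)"
  by (auto simp: simple_add_def simple_mul_def)


section \<open>Canonical terms for the elements of the model\<close>

abbreviation list_sum :: "'a tm list \<Rightarrow> 'a tm" where
  "list_sum ts \<equiv> foldr simple_add ts Zero"

lemma list_sum_insert: "list_sum (ts @ t # us) \<approx> simple_add t (list_sum (ts @ us))"
proof (induction ts)
  case (Cons s ts)
  let ?u = "list_sum (ts @ us)"
  have "list_sum ((s # ts) @ t # us) \<approx> simple_add s (simple_add t ?u)"
    using Cons by (simp add: simple_add_ac_cong)
  also have "\<dots> \<approx> simple_add (simple_add s t) ?u"
    by (rule simple_add_assoc)
  also have "\<dots> \<approx> simple_add (simple_add t s) ?u"
    by (simp add: simple_add_ac_cong simple_add_commute)
  also have "\<dots> \<approx> simple_add t (simple_add s ?u)"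
    by (rule ac_sym, rule simple_add_assoc)
  finally show ?case by simp
qed auto

lemma list_sum_cong: "mset ts = mset us \<Longrightarrow> list_sum ts \<approx> list_sum us"
proof (induction ts arbitrary: us)
  case (Cons t ts)
  then obtain us1 us2 where us: "us = us1 @ t # us2"
    by (metis list.set_intros(1) mset_eq_setD split_list)
  with Cons.prems have "list_sum ts \<approx> list_sum (us1 @ us2)"
    by (intro Cons.IH) simp
  then have "list_sum (t # ts) \<approx> simple_add t (list_sum (us1 @ us2))"
    by (simp add: simple_add_ac_cong)
  also have "\<dots> \<approx> list_sum us"
    unfolding us by (rule ac_sym, rule list_sum_insert)
  finally show ?case .
qed auto

text \<open>A multiset has no preferred order of summation, so one is chosen; every
  other choice gives an AC-equal term.\<close>

definition term_sum :: "'a tm multiset \<Rightarrow> 'a tm" where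
  "term_sum M = list_sum (SOME ts. mset ts = M)"

lemma term_sum_cases:
  obtains ts where "mset ts = M" "term_sum M = list_sum ts"
proof -
  have "mset (SOME ts. mset ts = M) = M"
    using ex_mset by (rule someI_ex)
  then show thesis
    using that unfolding term_sum_def by blast
qed

lemma term_sum_simps [simp]: "term_sum {#} = Zero" "term_sum {#t#} = t"
  by (rule term_sum_cases[of "{#}"], simp, rule term_sum_cases[of "{#t#}"], simp)

lemma term_sum_mset: "term_sum (mset ts) \<approx> list_sum ts"
  by (metis list_sum_cong term_sum_cases)

lemma term_sum_add_mset: "term_sum (add_mset t M) \<approx> simple_add t (term_sum M)"
proof (rule term_sum_cases[of M])
  fix ts assume ts: "mset ts = M" "term_sum M = list_sum ts"
  show ?thesis
    using term_sum_mset[of "t # ts"] ts by simp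
qed

primrec summand_term :: "'a summand \<Rightarrow> 'a tm" where
  "summand_term Unit = One"
| "summand_term (Lead x p) = simple_mul (Var x) (term_sum (image_mset summand_term p))"

definition poly_term :: "'a summand multiset \<Rightarrow> 'a tm" where
  "poly_term p = term_sum (image_mset summand_term p)"

lemma poly_term_simps [simp]:
  "poly_term {#} = Zero" "poly_term {#s#} = summand_term s"
  by (simp_all add: poly_term_def)

lemma summand_term_Lead: "summand_term (Lead x p) = simple_mul (Var x) (poly_term p)"
  by (simp add: poly_term_def)

declare summand_term.simps(2) [simp del]

lemma poly_term_add_mset: "poly_term (add_mset s p) \<approx> simple_add (summand_term s) (poly_term p)"
  by (simp add: poly_term_def term_sum_add_mset)

lemma poly_term_add: "poly_term (p + q) \<approx> simple_add (poly_term p) (poly_term q)"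
proof (induction p)
  case (add s p)
  have "poly_term (add_mset s p + q) \<approx> simple_add (summand_term s) (poly_term (p + q))"
    using poly_term_add_mset[of s "p + q"] by simp
  also have "\<dots> \<approx> simple_add (summand_term s) (simple_add (poly_term p) (poly_term q))"
    by (simp add: simple_add_ac_cong add)
  also have "\<dots> \<approx> simple_add (simple_add (summand_term s) (poly_term p)) (poly_term q)"
    by (rule simple_add_assoc)
  also have "\<dots> \<approx> simple_add (poly_term (add_mset s p)) (poly_term q)"
    by (simp add: simple_add_ac_cong ac_sym[OF poly_term_add_mset])
  finally show ?case .
qed auto

lemma PT_constants [simp]: "Zero \<in> PT X" "One \<in> PT X"
  by (rule PT.intros)+

lemma PT_simple_add: "s \<in> PT X \<Longrightarrow> t \<in> PT X \<Longrightarrow> simple_add s t \<in> PT X"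
  by (auto simp: simple_add_def intro: PT.intros)

lemma PT_simple_mul: "m \<in> monomial_terms X \<Longrightarrow> t \<in> PT X \<Longrightarrow> simple_mul m t \<in> PT X"
  by (auto simp: simple_mul_def intro: PT.intros)

lemma list_sum_in_PT: "set ts \<subseteq> PT X \<Longrightarrow> list_sum ts \<in> PT X"
  by (induction ts) (auto intro: PT_simple_add)

lemma term_sum_in_PT: "set_mset M \<subseteq> PT X \<Longrightarrow> term_sum M \<in> PT X"
  by (rule term_sum_cases[of M]) (auto intro: list_sum_in_PT)

lemma summand_term_in_PT: "s \<in> summands X \<Longrightarrow> summand_term s \<in> PT X"
proof (induction rule: summands.induct)
  case (Lead x p)
  then have "term_sum (image_mset summand_term p) \<in> PT X"
    by (intro term_sum_in_PT) auto
  with Lead show ?case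
    by (simp add: summand_term.simps(2) PT_simple_mul monomial_terms.intros)
qed auto

lemma poly_term_in_PT: "p \<in> polys X \<Longrightarrow> poly_term p \<in> PT X"
  unfolding poly_term_def using summand_term_in_PT
  by (intro term_sum_in_PT) (auto simp: polys_def)

lemma expand_list_sum: "expand (list_sum ts) = (\<Sum>t\<leftarrow>ts. expand t)"
  by (induction ts) auto

lemma expand_term_sum: "expand (term_sum M) = (\<Sum>t\<in>#M. expand t)"
  by (rule term_sum_cases[of M]) (simp add: expand_list_sum flip: sum_mset_sum_list)

lemma expand_summand_term: "s \<in> summands X \<Longrightarrow> expand (summand_term s) = {#s#}"
proof (induction rule: summands.induct)
  case (Lead x p)
  then have "expand (poly_term p) = (\<Sum>s\<in>#p. {#s#})"
    unfolding poly_term_def expand_term_sum image_mset.compositionality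
    by (intro arg_cong[where f = sum_mset] image_mset_cong) auto
  with Lead show ?case
    by (simp add: summand_term_Lead act_Lead)
qed auto

lemma expand_poly_term [simp]:
  assumes "p \<in> polys X"
  shows "expand (poly_term p) = p"
proof -
  have "expand (poly_term p) = (\<Sum>s\<in>#p. {#s#})"
    unfolding poly_term_def expand_term_sum image_mset.compositionality
    using assms expand_summand_term
    by (intro arg_cong[where f = sum_mset] image_mset_cong) (fastforce simp: polys_def)
  then show ?thesis by simp
qed

text \<open>A monomial acts on the model by prepending its variables, which leaves the sum in the second
  factor intact; so reordering and rebracketing are enough to bring the product into canonical form.\<close>

lemma poly_term_monomial_mul:
  "m \<in> monomial_terms X \<Longrightarrow> poly_term (mul (expand m) q) \<approx> simple_mul m (poly_term q)"
proof (induction arbitrary: q rule: monomial_terms.induct)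
  case (1 x)
  show ?case
    by (cases "q = {#}") (simp_all add: act_Lead summand_term_Lead)
next
  case (2 s t)
  have "poly_term (mul (expand (s \<^bold>\<times> t)) q) \<approx> simple_mul s (poly_term (mul (expand t) q))"
    using 2 by (simp add: mul_assoc)
  also have "\<dots> \<approx> simple_mul s (simple_mul t (poly_term q))"
    using 2 by (simp add: simple_mul_ac_cong)
  also have "\<dots> \<approx> simple_mul (simple_mul s t) (poly_term q)"
    by (rule simple_mul_assoc)
  also have "simple_mul s t = s \<^bold>\<times> t"
    using 2 monomial_terms_ST by (auto simp: simple_mul_def)
  finally show ?case .
qed

text \<open>On polynomial terms, passing to the model and back is possible by reordering alone: the
  left factor of each product is a monomial, so expanding never has to distribute.\<close>

lemma PT_ac_poly_term: "t \<in> PT X \<Longrightarrow> t \<approx> poly_term (expand t)"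
proof (induction rule: PT.induct)
  case (monomial m)
  have "poly_term (expand m) \<approx> m"
    using poly_term_monomial_mul[OF monomial, of "{#Unit#}"] by simp
  then show ?case by (rule ac_sym)
next
  case (sum s t)
  then have "s \<^bold>+ t \<approx> simple_add (poly_term (expand s)) (poly_term (expand t))"
    using simple_add_ac_cong by (fastforce simp: simple_add_def[of s t])
  also have "\<dots> \<approx> poly_term (expand s + expand t)"
    by (rule ac_sym, rule poly_term_add)
  finally show ?case by simp
next
  case (prod m t)
  then have "m \<^bold>\<times> t \<approx> simple_mul m (poly_term (expand t))"
    using simple_mul_ac_cong[of m m t] monomial_terms_ST[of m X] by (auto simp: simple_mul_def[of m t])
  also have "\<dots> \<approx> poly_term (mul (expand m) (expand t))"
    using prod by (intro ac_sym[OF poly_term_monomial_mul])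
  finally show ?case by simp
qed auto

section \<open>The classes of polynomial terms\<close>

definition poly_class :: "'a set \<Rightarrow> 'a summand multiset \<Rightarrow> 'a tm set" where
  "poly_class X p = AC_class X (poly_term p)"

lemma poly_term_in_ST: "p \<in> polys X \<Longrightarrow> poly_term p \<in> ST X"
  using poly_term_in_PT PT_subset_ST by blast

lemma PT_subset_T: "PT X \<subseteq> T X"
  using PT_subset_ST ST_subset_T by blast

lemma AC_class_PT:
  assumes "t \<in> PT X"
  shows "AC_class X t = poly_class X (expand t)" "expand t \<in> polys X"
proof -
  show "expand t \<in> polys X"
    using assms PT_subset_T by (blast intro: expand_in_polys)
  then show "AC_class X t = poly_class X (expand t)"
    unfolding poly_class_def using assms PT_subset_ST
    by (subst AC_class_eq_iff) (auto intro: poly_term_in_ST PT_ac_poly_term)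
qed

text \<open>AC-equal terms have the same value in the model; hence the class determines the multiset.\<close>

lemma poly_class_inject [simp]:
  "p \<in> polys X \<Longrightarrow> q \<in> polys X \<Longrightarrow> poly_class X p = poly_class X q \<longleftrightarrow> p = q"
  using expand_ac[of "poly_term p" "poly_term q"]
  by (auto simp: poly_class_def AC_class_eq_iff poly_term_in_ST)

lemma polynomials_eq: "polynomials X = poly_class X ` polys X"
proof
  show "polynomials X \<subseteq> poly_class X ` polys X"
    unfolding polynomials_def using AC_class_PT by blast
  show "poly_class X ` polys X \<subseteq> polynomials X"
    unfolding polynomials_def poly_class_def using poly_term_in_PT by blast
qed

lemma poly_class_in_polynomials: "p \<in> polys X \<Longrightarrow> poly_class X p \<in> polynomials X"
  by (auto simp: polynomials_eq)

lemma poly_class_constants: "poly_class X {#} = zero_AC X" "poly_class X {#Unit#} = one_AC X"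
  by (simp_all add: poly_class_def zero_AC_def one_AC_def)

lemma poly_class_eq_constant_iff:
  assumes "p \<in> polys X"
  shows "poly_class X p = zero_AC X \<longleftrightarrow> p = {#}" "poly_class X p = one_AC X \<longleftrightarrow> p = {#Unit#}"
  using assms by (simp_all flip: poly_class_constants)

lemma add_poly_class:
  assumes "p \<in> polys X" "q \<in> polys X"
  shows "add_AC X (poly_class X p) (poly_class X q) = poly_class X (p + q)"
proof -
  have "simple_add (poly_term p) (poly_term q) \<approx> poly_term (p + q)"
    by (rule ac_sym, rule poly_term_add)
  then show ?thesis
    unfolding poly_class_def using assms
    by (simp add: add_AC_class poly_term_in_ST AC_class_eq_iff simple_op_in_ST)
qed

lemma monomial_terms_subset_PT: "monomial_terms X \<subseteq> PT X"
  by (auto intro: PT.monomial)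

lemma expand_monomial_in_polys: "m \<in> monomial_terms X \<Longrightarrow> expand m \<in> polys X"
  using monomial_terms_subset_PT AC_class_PT(2) by blast

lemma monomials_eq: "monomials X = (\<lambda>m. poly_class X (expand m)) ` monomial_terms X"
  unfolding monomials_def
  by (intro image_cong refl AC_class_PT(1) subsetD[OF monomial_terms_subset_PT])

lemma mult_monomial_class:
  assumes "m \<in> monomial_terms X" "p \<in> polys X"
  shows "mult_AC X (poly_class X (expand m)) (poly_class X p) = poly_class X (mul (expand m) p)"
proof -
  have m: "m \<in> PT X" "m \<in> ST X"
    using assms monomial_terms_subset_PT PT_subset_ST by blast+
  have "simple_mul m (poly_term p) \<approx> poly_term (mul (expand m) p)"
    using assms(1) by (intro ac_sym[OF poly_term_monomial_mul])
  then show ?thesis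
    unfolding AC_class_PT(1)[OF m(1), symmetric] using assms m
    by (simp add: poly_class_def mult_AC_class poly_term_in_ST AC_class_eq_iff simple_op_in_ST
        mul_in_polys expand_monomial_in_polys)
qed

lemma poly_term_eq_constant_iff:
  assumes "p \<in> polys X"
  shows "poly_term p = Zero \<longleftrightarrow> p = {#}" "poly_term p = One \<longleftrightarrow> p = {#Unit#}"
  using assms by (metis expand_poly_term expand.simps(2,3) poly_term_simps summand_term.simps(1))+

lemma set_mset_sum_list: "set_mset (sum_list ps) = (\<Union>p\<in>set ps. set_mset p)"
  by (induction ps) auto

lemma sum_poly_classes:
  "set ps \<subseteq> polys X \<Longrightarrow> sum_AC X (map (poly_class X) ps) = poly_class X (sum_list ps)"
proof (induction ps)
  case (Cons p ps)
  then have "sum_list ps \<in> polys X"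
    by (auto simp: polys_def set_mset_sum_list)
  with Cons show ?case
    by (simp add: sum_AC_def add_poly_class)
qed (simp add: sum_AC_def poly_class_constants)

lemma sum_polynomial_class:
  assumes "p \<in> polys X" "size p \<ge> 2"
  shows "poly_class X p \<in> sum_polynomials X"
proof -
  obtain s q where p: "p = add_mset s q" "q \<noteq> {#}"
    using assms(2) by (cases p) (auto, force)
  then have mem: "{#s#} \<in> polys X" "q \<in> polys X"
    using assms(1) by auto
  have "poly_term u \<in> PT X - {Zero}" if "u \<in> polys X" "u \<noteq> {#}" for u
    using that poly_term_in_PT poly_term_eq_constant_iff(1) by blast
  from this[OF mem(1)] this[OF mem(2) p(2)]
  have "poly_term {#s#} \<in> PT X - {Zero}" "poly_term q \<in> PT X - {Zero}"
    by auto
  moreover from this have "poly_class X p = AC_class X (poly_term {#s#} \<^bold>+ poly_term q)"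
    using add_poly_class[OF mem] mem p(1)
    by (simp add: poly_class_def add_AC_class poly_term_in_ST[of "{#s#}", simplified]
        poly_term_in_ST simple_add_def)
  ultimately show ?thesis
    unfolding sum_polynomials_def sum_polynomial_terms_def by blast
qed

lemma summand_class:
  assumes "s \<in> summands X"
  shows "poly_class X {#s#} \<in> product_polynomials X \<union> variable_classes X \<union> {one_AC X}"
proof (cases s)
  case Unit
  then show ?thesis by (simp add: poly_class_constants)
next
  case (Lead x p)
  with assms have xp: "x \<in> X" "p \<in> polys X" "p \<noteq> {#}" by auto
  show ?thesis
  proof (cases "p = {#Unit#}")
    case True
    with Lead xp show ?thesis
      by (auto simp: poly_class_def summand_term_Lead variable_classes_def)
  next
    case False
    with xp have p: "poly_term p \<noteq> Zero" "poly_term p \<noteq> One" "poly_term p \<in> PT X"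
      using poly_term_eq_constant_iff[OF xp(2)] poly_term_in_PT by auto
    with Lead xp have "summand_term s = Var x \<^bold>\<times> poly_term p"
      by (simp add: summand_term_Lead simple_mul_def)
    with p xp have "summand_term s \<in> product_polynomial_terms X"
      by (auto simp: product_polynomial_terms_def intro: monomial_terms.intros)
    then show ?thesis
      by (auto simp: poly_class_def product_polynomials_def)
  qed
qed

text \<open>The unique maximal monomial at the beginning of a summand is found by stripping leading variables
  until the tail is \<open>1\<close> or branches into at least two summands. The branching tail is lighter, which
  makes the recursion for \<open>\<times>\<^sub>r\<^sub>d\<close> terminate.\<close>

lemma summand_cases:
  assumes "s \<in> summands X"
  obtains (unit) "s = Unit"
  | (monomial) m where "m \<in> monomial_terms X" "{#s#} = expand m"
  | (product) m p where "m \<in> monomial_terms X" "p \<in> polys X" "size p \<ge> 2"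
      "total_weight p < weight s" "{#s#} = mul (expand m) p"
proof -
  have "s = Unit \<or> (\<exists>m\<in>monomial_terms X. {#s#} = expand m) \<or>
    (\<exists>m\<in>monomial_terms X. \<exists>p\<in>polys X. size p \<ge> 2 \<and> total_weight p < weight s \<and>
      {#s#} = mul (expand m) p)"
    using assms
  proof (induction rule: summands.induct)
    case (Lead x p)
    have x: "Var x \<in> monomial_terms X"
      using Lead by (intro monomial_terms.intros)
    have s: "{#Lead x p#} = mul (expand (Var x)) p"
      using Lead by (simp add: act_Lead)
    show ?case
    proof (cases "size p \<ge> 2")
      case True
      moreover have "p \<in> polys X"
        using Lead by (auto simp: polys_def)
      ultimately show ?thesis
        using x s by (intro disjI2) (auto intro!: bexI[of _ "Var x"] bexI[of _ p])
    next
      case False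
      moreover have "size p \<noteq> 0"
        using Lead(2) by simp
      ultimately have "size p = 1" by linarith
      then obtain u where u: "p = {#u#}"
        using size_1_singleton_mset by blast
      with Lead consider "u = Unit" | m where "m \<in> monomial_terms X" "{#u#} = expand m"
        | m q where "m \<in> monomial_terms X" "q \<in> polys X" "size q \<ge> 2" "total_weight q < weight u"
          "{#u#} = mul (expand m) q"
        by (metis union_single_eq_member add_mset_add_single empty_neutral(1))
      then show ?thesis
      proof cases
        case 1
        then show ?thesis
          using x u by (intro disjI2 disjI1 bexI[of _ "Var x"]) auto
      next
        case 2
        then have "{#Lead x p#} = expand (Var x \<^bold>\<times> m)"
          using s u by simp
        then show ?thesis
          using x 2 monomial_terms.intros(2) by blast
      next
        case 3
        then have "{#Lead x p#} = mul (expand (Var x \<^bold>\<times> m)) q"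
          using s u by (simp add: mul_act)
        moreover have "total_weight q < weight (Lead x p)"
          using 3(4) u by simp
        ultimately show ?thesis
          using x 3 monomial_terms.intros(2) by blast
      qed
    qed
  qed auto
  with that show thesis by blast
qed


section \<open>The multiplication of polynomials\<close>

text \<open>Each rule of the graph is an identity of the model. Since a class determines its element
  of the model, the graph is single-valued, whatever decompositions its rules use.\<close>

lemma times_rd_graph_sound:
  assumes "times_rd_graph X c d e"
  shows "\<exists>p\<in>polys X. \<exists>q\<in>polys X. c = poly_class X p \<and> d = poly_class X q \<and> e = poly_class X (mul p q)"
  using assms
proof (induction rule: times_rd_graph.induct)
  case (zero_right q)
  then show ?case
    by (force simp: polynomials_eq simp flip: poly_class_constants)
next
  case (zero_left q)
  then show ?case
    by (force simp: polynomials_eq simp flip: poly_class_constants)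
next
  case (one_right q)
  then obtain p where "p \<in> polys X" "q = poly_class X p"
    by (auto simp: polynomials_eq)
  then show ?case
    by (intro bexI[of _ p] bexI[of _ "{#Unit#}"]) (auto simp flip: poly_class_constants)
next
  case (one_left q)
  then obtain p where "p \<in> polys X" "q = poly_class X p"
    by (auto simp: polynomials_eq)
  then show ?case
    by (intro bexI[of _ p] bexI[of _ "{#Unit#}"]) (auto simp flip: poly_class_constants)
next
  case (monomial q r)
  then obtain m p where "m \<in> monomial_terms X" "q = poly_class X (expand m)"
      "p \<in> polys X" "r = poly_class X p"
    by (auto simp: polynomials_eq monomials_eq)
  then show ?case
    by (intro bexI[of _ "expand m"] bexI[of _ p])
      (auto simp: mult_monomial_class expand_monomial_in_polys)
next
  case (sum q r qs ps)
  then obtain u where u: "u \<in> polys X" "r = poly_class X u"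
    by (auto simp: polynomials_eq)
  have "\<exists>vs. set vs \<subseteq> polys X \<and> qs = map (poly_class X) vs \<and>
      ps = map (poly_class X) (map (\<lambda>v. mul v u) vs)"
    using sum.IH
  proof (induction rule: list_all2_induct)
    case (Cons q' qs p' ps)
    then obtain v vs where "v \<in> polys X" "q' = poly_class X v" "p' = poly_class X (mul v u)"
        "set vs \<subseteq> polys X" "qs = map (poly_class X) vs"
        "ps = map (poly_class X) (map (\<lambda>v. mul v u) vs)"
      using u by auto
    then show ?case
      by (intro exI[of _ "v # vs"]) auto
  qed auto
  then obtain vs where vs: "set vs \<subseteq> polys X" "qs = map (poly_class X) vs"
      "ps = map (poly_class X) (map (\<lambda>v. mul v u) vs)"
    by blast
  have "(\<Sum>v\<leftarrow>vs. mul v u) = mul (sum_list vs) u"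
    by (induction vs) auto
  moreover have "set (map (\<lambda>v. mul v u) vs) \<subseteq> polys X"
    using vs u by (auto intro: mul_in_polys)
  ultimately have "sum_AC X ps = poly_class X (mul (sum_list vs) u)"
    using vs sum_poly_classes by metis
  moreover have "q = poly_class X (sum_list vs)"
    using vs sum.hyps sum_poly_classes by metis
  moreover have "sum_list vs \<in> polys X"
    using vs by (auto simp: polys_def set_mset_sum_list)
  ultimately show ?case
    using u by blast
next
  case (prod q m q' r p)
  then obtain n v u where "n \<in> monomial_terms X" "m = poly_class X (expand n)"
    "v \<in> polys X" "q' = poly_class X v" "u \<in> polys X" "r = poly_class X u"
    "p = poly_class X (mul v u)"
    by (auto simp: monomials_eq)
  with prod.hyps(1) show ?case
    by (intro bexI[of _ "mul (expand n) v"] bexI[of _ u])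
      (auto simp: mult_monomial_class mul_in_polys mul_assoc expand_monomial_in_polys)
qed

text \<open>Both kinds of recursive call reduce the weight of the left factor: a sum has at least two
  summands, each of them lighter than the sum, and a product loses at least one variable.\<close>

lemma times_rd_graph_complete:
  "p \<in> polys X \<Longrightarrow> q \<in> polys X \<Longrightarrow>
    times_rd_graph X (poly_class X p) (poly_class X q) (poly_class X (mul p q))"
proof (induction "total_weight p" arbitrary: p rule: less_induct)
  case less
  note q = \<open>q \<in> polys X\<close>
  consider "q = {#}" | "q = {#Unit#}" | "q \<noteq> {#}" "q \<noteq> {#Unit#}" by blast
  then show ?case
  proof cases
    case 1
    with less show ?thesis
      by (simp add: poly_class_constants times_rd_graph.zero_right poly_class_in_polynomials)
  next
    case 2
    with less show ?thesis
      by (simp add: poly_class_constants times_rd_graph.one_right poly_class_in_polynomials)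
  next
    case 3
    with q have qc: "poly_class X q \<in> polynomials X - {zero_AC X, one_AC X}"
      by (simp add: poly_class_eq_constant_iff poly_class_in_polynomials)
    consider "p = {#}" | s where "p = {#s#}" | "size p \<ge> 2"
      by (cases p rule: multiset_cases; cases "size p \<ge> 2") (auto simp: not_le less_Suc_eq numeral_2_eq_2)
    then show ?thesis
    proof cases
      case 1
      with q show ?thesis
        by (simp add: poly_class_constants times_rd_graph.zero_left poly_class_in_polynomials)
    next
      case (2 s)
      with less have "s \<in> summands X" by simp
      then show ?thesis
      proof (cases rule: summand_cases)
        case unit
        with q 2 show ?thesis
          by (simp add: poly_class_constants times_rd_graph.one_left poly_class_in_polynomials)
      next
        case (monomial m)
        have "times_rd_graph X (poly_class X p) (poly_class X q)
            (mult_AC X (poly_class X p) (poly_class X q))"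
          using monomial 2 qc by (intro times_rd_graph.monomial) (auto simp: monomials_eq)
        then show ?thesis
          using monomial 2 q by (simp add: mult_monomial_class del: mul_simps(2))
      next
        case (product m v)
        have "times_rd_graph X (poly_class X v) (poly_class X q) (poly_class X (mul v q))"
        proof (rule less.hyps)
          show "total_weight v < total_weight p"
            using product(4) 2 by simp
        qed (use product q in auto)
        moreover have "poly_class X p = mult_AC X (poly_class X (expand m)) (poly_class X v)"
          using product 2 by (simp add: mult_monomial_class)
        ultimately have "times_rd_graph X (poly_class X p) (poly_class X q)
            (mult_AC X (poly_class X (expand m)) (poly_class X (mul v q)))"
          using product qc
          by (intro times_rd_graph.prod) (auto simp: monomials_eq sum_polynomial_class)
        then show ?thesis
          using product 2 q
          by (simp add: mult_monomial_class mul_in_polys mul_assoc del: mul_simps(2))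
      qed
    next
      case 3
      obtain ss where ss: "mset ss = p" using ex_mset by blast
      then have mem: "set ss \<subseteq> summands X"
        using less by (auto simp: polys_def)
      have single: "times_rd_graph X (poly_class X {#s#}) (poly_class X q) (poly_class X (act q s))"
        if "s \<in> set ss" for s
      proof -
        have "s \<in># p"
          using ss that by auto
        then obtain p' where p': "p = add_mset s p'"
          by (meson mset_add)
        moreover from this obtain u p'' where "p' = add_mset u p''"
          using 3 by (cases p') auto
        ultimately have "total_weight {#s#} < total_weight p"
          using weight_pos[of u] by simp
        then show ?thesis
          using less.hyps[of "{#s#}"] that mem q by auto
      qed
      have sum_act: "(\<Sum>s\<leftarrow>ss. act q s) = mul p q"
        unfolding ss[symmetric] by (induction ss) auto
      let ?qs = "map (poly_class X) (map (\<lambda>s. {#s#}) ss)"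
        and ?ps = "map (poly_class X) (map (act q) ss)"
      have "times_rd_graph X (poly_class X p) (poly_class X q) (sum_AC X ?ps)"
      proof (rule times_rd_graph.sum)
        show "poly_class X p = sum_AC X ?qs"
          using mem by (subst sum_poly_classes) (auto simp: ss)
        show "length ?qs \<ge> 2"
          using 3 ss by auto
        show "set ?qs \<subseteq> product_polynomials X \<union> variable_classes X \<union> {one_AC X}"
          using mem summand_class by auto
        show "list_all2 (\<lambda>q' p'. times_rd_graph X q' (poly_class X q) p') ?qs ?ps"
          using single by (auto simp: list_all2_conv_all_nth)
      qed (use 3 less.prems qc sum_polynomial_class in auto)
      also have "sum_AC X ?ps = poly_class X (mul p q)"
        using mem q by (subst sum_poly_classes) (auto simp: sum_act intro: act_in_polys)
      finally show ?thesis .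
    qed
  qed
qed

lemma times_rd_poly_class:
  assumes "p \<in> polys X" "q \<in> polys X"
  shows "times_rd X (poly_class X p) (poly_class X q) = poly_class X (mul p q)"
  unfolding times_rd_def
proof (rule the_equality)
  show "times_rd_graph X (poly_class X p) (poly_class X q) (poly_class X (mul p q))"
    using assms by (rule times_rd_graph_complete)
  show "e = poly_class X (mul p q)"
    if "times_rd_graph X (poly_class X p) (poly_class X q) e" for e
    using times_rd_graph_sound[OF that] assms by auto
qed


section \<open>The free right-distributive strong bimonoid\<close>

locale right_distributive_congruence = bimonoid_congruence +
  assumes rd_pairs: "rd_pairs X \<subseteq> R"
begin

lemma right_distrib:
  "a \<in> T X \<Longrightarrow> b \<in> T X \<Longrightarrow> c \<in> T X \<Longrightarrow> ((a \<^bold>+ b) \<^bold>\<times> c, a \<^bold>\<times> c \<^bold>+ b \<^bold>\<times> c) \<in> R"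
  using rd_pairs unfolding rd_pairs_def by blast

lemma poly_term_in_T: "p \<in> polys X \<Longrightarrow> poly_term p \<in> T X"
  using poly_term_in_ST ST_subset_T by blast

lemma poly_term_add_eq:
  assumes "p \<in> polys X" "q \<in> polys X"
  shows "(poly_term (p + q), poly_term p \<^bold>+ poly_term q) \<in> R"
proof -
  have "(poly_term (p + q), simple_add (poly_term p) (poly_term q)) \<in> R"
    using assms by (intro ac_eq poly_term_add poly_term_in_T) simp
  then show ?thesis
    using assms by (blast intro: trans simple_add_eq poly_term_in_T)
qed

text \<open>The hypothesis on the summands is the induction hypothesis available for the tail of \<open>Lead x p\<close>
  in the proof of \<open>poly_term_act_eq\<close>, before the statement is known for all summands.\<close>

lemma poly_term_mul_eq_if:
  assumes "p \<in> polys X" "q \<in> polys X"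
    and act: "\<And>s. s \<in># p \<Longrightarrow> (poly_term (act q s), summand_term s \<^bold>\<times> poly_term q) \<in> R"
  shows "(poly_term (mul p q), poly_term p \<^bold>\<times> poly_term q) \<in> R"
  using assms(1) act
proof (induction p)
  case empty
  then show ?case
    using assms(2) by (auto intro: sym axioms poly_term_in_T)
next
  case (add s p)
  let ?q = "poly_term q"
  have mem: "s \<in> summands X" "p \<in> polys X" "{#s#} \<in> polys X"
    using add.prems(1) by auto
  note inT = poly_term_in_T[OF mem(2)] poly_term_in_T[OF assms(2)]
    poly_term_in_T[OF mem(3), simplified]
  have "(poly_term (mul (add_mset s p) q), poly_term (act q s) \<^bold>+ poly_term (mul p q)) \<in> R"
    using poly_term_add_eq[of "act q s" "mul p q"] mem assms(2)
    by (simp add: act_in_polys mul_in_polys)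
  moreover have "(poly_term (act q s) \<^bold>+ poly_term (mul p q),
      summand_term s \<^bold>\<times> ?q \<^bold>+ poly_term p \<^bold>\<times> ?q) \<in> R"
    using add mem by (auto intro: bimonoid_congruence.add[OF bimonoid_congruence_axioms])
  moreover have "(summand_term s \<^bold>\<times> ?q \<^bold>+ poly_term p \<^bold>\<times> ?q,
      (summand_term s \<^bold>+ poly_term p) \<^bold>\<times> ?q) \<in> R"
    using inT by (intro sym[OF right_distrib])
  moreover have "((summand_term s \<^bold>+ poly_term p) \<^bold>\<times> ?q, poly_term (add_mset s p) \<^bold>\<times> ?q) \<in> R"
    using poly_term_add_eq[OF mem(3,2)] inT by (auto intro: mul sym refl)
  ultimately show ?case by (blast intro: trans)
qed

lemma poly_term_act_eq:
  "s \<in> summands X \<Longrightarrow> q \<in> polys X \<Longrightarrow> (poly_term (act q s), summand_term s \<^bold>\<times> poly_term q) \<in> R"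
proof (induction rule: summands.induct)
  case Unit
  then show ?case
    by (auto intro: sym axioms poly_term_in_T)
next
  case (Lead x p)
  have p: "p \<in> polys X" "Lead x p \<in> summands X"
    using Lead by (auto simp: polys_def)
  note inT = poly_term_in_T[OF p(1)] poly_term_in_T[OF Lead.prems]
    poly_term_in_T[OF mul_in_polys[OF p(1) Lead.prems]]
  show ?case
  proof (cases "q = {#}")
    case True
    then show ?thesis
      using p poly_term_in_T[of "{#Lead x p#}"] by (auto intro: sym axioms)
  next
    case False
    have "(simple_mul (Var x) (poly_term (mul p q)), Var x \<^bold>\<times> poly_term (mul p q)) \<in> R"
      using inT Lead by (intro simple_mul_eq) auto
    moreover have "(poly_term (mul p q), poly_term p \<^bold>\<times> poly_term q) \<in> R"
      using p Lead by (intro poly_term_mul_eq_if) auto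
    then have "(Var x \<^bold>\<times> poly_term (mul p q), Var x \<^bold>\<times> (poly_term p \<^bold>\<times> poly_term q)) \<in> R"
      using Lead by (intro mul refl) auto
    moreover have "(Var x \<^bold>\<times> (poly_term p \<^bold>\<times> poly_term q), Var x \<^bold>\<times> poly_term p \<^bold>\<times> poly_term q) \<in> R"
      using inT Lead by (intro axioms) auto
    moreover have "(Var x \<^bold>\<times> poly_term p, simple_mul (Var x) (poly_term p)) \<in> R"
      using inT Lead by (intro sym[OF simple_mul_eq]) auto
    then have "(Var x \<^bold>\<times> poly_term p \<^bold>\<times> poly_term q,
        simple_mul (Var x) (poly_term p) \<^bold>\<times> poly_term q) \<in> R"
      using inT by (intro mul refl)
    ultimately show ?thesis
      using False by (simp add: act_Lead summand_term_Lead) (blast intro: trans)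
  qed
qed

lemma poly_term_mul_eq:
  "p \<in> polys X \<Longrightarrow> q \<in> polys X \<Longrightarrow> (poly_term (mul p q), poly_term p \<^bold>\<times> poly_term q) \<in> R"
  by (intro poly_term_mul_eq_if poly_term_act_eq) (auto simp: polys_def)

text \<open>Modulo \<open>R\<close> the canonical terms multiply like the elements of the model, so a term can be brought
  into canonical form from its leaves upwards. This is the completeness half of the presentation.\<close>

lemma expand_eq: "t \<in> T X \<Longrightarrow> (t, poly_term (expand t)) \<in> R"
proof (induction t)
  case (Var x)
  then show ?case
    by (auto simp: summand_term_Lead intro: refl)
next
  case (Add s t)
  then have "(s \<^bold>+ t, poly_term (expand s) \<^bold>+ poly_term (expand t)) \<in> R"
    by (auto intro: add)
  moreover have "(poly_term (expand s) \<^bold>+ poly_term (expand t), poly_term (expand s + expand t)) \<in> R"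
    using Add by (intro sym[OF poly_term_add_eq] expand_in_polys) auto
  ultimately show ?case
    by (auto intro: trans)
next
  case (Mul s t)
  then have "(s \<^bold>\<times> t, poly_term (expand s) \<^bold>\<times> poly_term (expand t)) \<in> R"
    by (auto intro: mul)
  moreover have "(poly_term (expand s) \<^bold>\<times> poly_term (expand t), poly_term (mul (expand s) (expand t))) \<in> R"
    using Mul by (intro sym[OF poly_term_mul_eq] expand_in_polys) auto
  ultimately show ?case
    by (auto intro: trans)
qed (auto intro: refl)

end

lemma evaluation_N_rd: "evaluation X (N_rd X) (\<lambda>t. poly_class X (expand t))"
proof
  have "polys X \<subseteq> expand ` T X"
    using expand_poly_term poly_term_in_ST ST_subset_T by (metis image_eqI subsetD subsetI)
  then have "polys X = expand ` T X"
    using expand_in_polys by blast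
  then show "carrier (N_rd X) = (\<lambda>t. poly_class X (expand t)) ` T X"
    by (simp add: N_rd_def polynomials_eq image_image)
qed (simp_all add: N_rd_def poly_class_constants add_poly_class times_rd_poly_class expand_in_polys)

theorem free_right_distributive_strong_bimonoid:
  "strong_bimonoid (FB_rd X) \<and> strong_bimonoid (N_rd X) \<and> FB_rd X \<cong>\<^sub>s\<^sub>b N_rd X"
proof -
  interpret evaluation X "N_rd X" "\<lambda>t. poly_class X (expand t)"
    by (rule evaluation_N_rd)
  let ?P = "E_pairs X \<union> rd_pairs X"
  have P: "?P \<subseteq> T X \<times> T X" "?P \<subseteq> congruence_generated_by X ?P"
    using generating_pairs_subset generators_subset by blast+
  interpret R: right_distributive_congruence X "congruence_generated_by X ?P"
    using bimonoid_congruence_generated_by[OF P(1)] P(2)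
    by (auto simp: right_distributive_congruence_def right_distributive_congruence_axioms_def)
  show ?thesis
    unfolding FB_rd_def eq_E_rd_def
  proof (rule presentation)
    show "(s, t) \<in> congruence_generated_by X ?P"
      if st: "s \<in> T X" "t \<in> T X" and eq: "poly_class X (expand s) = poly_class X (expand t)" for s t
    proof -
      have "expand s = expand t"
        using eq st by (simp add: expand_in_polys)
      then show ?thesis
        using R.expand_eq[OF st(1)] R.expand_eq[OF st(2)] by (auto intro: R.trans R.sym)
    qed
    show "poly_class X (expand s) = poly_class X (expand t)" if "(s, t) \<in> ?P" for s t
      using expand_E_rd_pairs[OF that] by simp
  qed (use P(1) in auto)
qed

section \<open>Multiplicity-free polynomials\<close>

definition multiplicity_free :: "'a multiset \<Rightarrow> bool" where
  "multiplicity_free p \<longleftrightarrow> (\<forall>s. count p s \<le> 1)"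

lemma multiplicity_free_simps [simp]:
  "multiplicity_free {#}"
  "multiplicity_free (add_mset s p) \<longleftrightarrow> s \<notin># p \<and> multiplicity_free p"
  by (auto simp: multiplicity_free_def not_in_iff le_Suc_eq)

lemma multiplicity_free_mset [simp]: "multiplicity_free (mset ss) \<longleftrightarrow> distinct ss"
  by (induction ss) auto

lemma multiplicity_free_add:
  "multiplicity_free (p + q) \<longleftrightarrow>
    multiplicity_free p \<and> multiplicity_free q \<and> set_mset p \<inter> set_mset q = {}"
  by (induction p) auto

lemma multiplicity_free_filter: "multiplicity_free p \<Longrightarrow> multiplicity_free (filter_mset P p)"
  by (auto simp: multiplicity_free_def)

lemma multiplicity_free_eqI:
  assumes "multiplicity_free p" "multiplicity_free q" "set_mset p = set_mset q"
  shows "p = q"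
proof (rule multiset_eqI)
  fix s
  have "count r s = (if s \<in># r then 1 else 0)" if "multiplicity_free r" for r :: "'a multiset"
    using that unfolding multiplicity_free_def
    by (metis One_nat_def Suc_leI count_greater_zero_iff le_antisym not_in_iff)
  with assms show "count p s = count q s" by auto
qed

inductive_set reduced_summands :: "'a set \<Rightarrow> 'a summand set" for X where
  Unit: "Unit \<in> reduced_summands X"
| Lead: "x \<in> X \<Longrightarrow> p \<noteq> {#} \<Longrightarrow> multiplicity_free p \<Longrightarrow>
    (\<And>s. s \<in># p \<Longrightarrow> s \<in> reduced_summands X) \<Longrightarrow> Lead x p \<in> reduced_summands X"

definition reduced_polys :: "'a set \<Rightarrow> 'a summand multiset set" where
  "reduced_polys X = {p. multiplicity_free p \<and> set_mset p \<subseteq> reduced_summands X}"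

lemma reduced_polysD:
  "p \<in> reduced_polys X \<Longrightarrow> multiplicity_free p"
  "p \<in> reduced_polys X \<Longrightarrow> s \<in># p \<Longrightarrow> s \<in> reduced_summands X"
  by (auto simp: reduced_polys_def)

lemma reduced_polys_simps [simp]:
  "{#} \<in> reduced_polys X"
  "add_mset s p \<in> reduced_polys X \<longleftrightarrow> s \<in> reduced_summands X \<and> s \<notin># p \<and> p \<in> reduced_polys X"
  by (auto simp: reduced_polys_def)

lemma Unit_in_reduced_summands [simp]: "Unit \<in> reduced_summands X"
  by (rule reduced_summands.Unit)

lemma Lead_in_reduced_summands [simp]:
  "Lead x p \<in> reduced_summands X \<longleftrightarrow> x \<in> X \<and> p \<noteq> {#} \<and> p \<in> reduced_polys X"
  by (auto simp: reduced_polys_def intro: reduced_summands.Lead elim: reduced_summands.cases)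

lemma reduced_summands_subset: "reduced_summands X \<subseteq> summands X"
proof
  show "s \<in> summands X" if "s \<in> reduced_summands X" for s
    using that by (induction rule: reduced_summands.induct) (auto simp: polys_def)
qed

lemma reduced_polys_subset: "reduced_polys X \<subseteq> polys X"
  using reduced_summands_subset by (auto simp: reduced_polys_def polys_def)

lemma total_weight_mul: "total_weight (mul p q) = (\<Sum>s\<in>#p. total_weight (act q s))"
  by (induction p) auto

lemma total_weight_act: "s \<in> summands X \<Longrightarrow> total_weight q \<le> total_weight (act q s)"
proof (induction rule: summands.induct)
  case (Lead x p)
  then obtain s p' where "p = add_mset s p'"
    by (meson multiset_cases)
  with Lead show ?case
    by (cases "q = {#}") (auto simp: act_Lead total_weight_mul intro: le_SucI trans_le_add1)
qed auto

lemma total_weight_mul_ge: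
  assumes "p \<in> polys X" "p \<noteq> {#}"
  shows "total_weight q \<le> total_weight (mul p q)"
proof -
  obtain s p' where "p = add_mset s p'"
    using assms(2) by (meson multiset_cases)
  with assms show ?thesis
    using total_weight_act[of s X q] by simp
qed

lemma weight_le_total_weight: "e \<in># q \<Longrightarrow> weight e \<le> total_weight q"
  by (auto dest!: multi_member_split)

text \<open>For \<open>Unit\<close> against \<open>Lead x p\<close> the reason is weight: \<open>Lead x (mul p q)\<close> is heavier than all of
  \<open>q\<close>. For two summands with the same leading variable, the claim for the members of their tails
  yields right cancellation for the tails. Because of this lemma products stay multiplicity-free, and
  \<open>\<times>\<^sub>r\<^sub>d\<close> serves the idempotent case too.\<close>

lemma act_disjoint:
  "s \<in> reduced_summands X \<Longrightarrow> s' \<in> reduced_summands X \<Longrightarrow> e \<in># act q s \<Longrightarrow> e \<in># act q s' \<Longrightarrow> s = s'"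
proof (induction arbitrary: s' e rule: reduced_summands.induct)
  \<comment> \<open>All summands of \<open>q\<close> are at most as heavy as \<open>q\<close>, hence lighter than any multiple of \<open>q\<close>
    with a further leading variable.\<close>
  have unit_lead: False
    if "Lead x p \<in> reduced_summands X" "e \<in># q" "e \<in># act q (Lead x p)" for x p e
  proof -
    have p: "p \<in> polys X" "p \<noteq> {#}" "q \<noteq> {#}"
      using that reduced_polys_subset by auto
    then have "e = Lead x (mul p q)"
      using that by (simp add: act_Lead)
    then have "Suc (total_weight (mul p q)) \<le> total_weight q"
      using weight_le_total_weight[OF that(2)] by simp
    with total_weight_mul_ge[OF p(1,2), of q] show False by simp
  qed
  {
    case Unit
    show ?case
    proof (cases s')
      case (Lead x p)
      with Unit.prems unit_lead[of x p e] show ?thesis by auto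
    qed simp
  next
    case (Lead x p)
    have q: "q \<noteq> {#}"
      using Lead.prems by auto
    have lead: "Lead x p \<in> reduced_summands X"
      using Lead.hyps by (rule reduced_summands.Lead)
    obtain p' where s': "s' = Lead x p'" and eq: "mul p q = mul p' q"
      using Lead.prems unit_lead[OF lead] q by (cases s') (auto simp: act_Lead)
    have p': "p' \<in> reduced_polys X"
      using Lead.prems s' by simp
    have tails: "u = u'" if "u \<in># p" "u' \<in># p'" "d \<in># act q u" "d \<in># act q u'" for u u' d
      using Lead.IH that p' by (auto simp: reduced_polys_def)
    \<comment> \<open>Any member of \<open>act q u\<close> identifies \<open>u\<close>, so \<open>p\<close> and \<open>p'\<close> can be read off from their common product.\<close>
    have "set_mset p = set_mset p'"
    proof (intro equalityI subsetI)
      fix u assume u: "u \<in># p"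
      obtain d where d: "d \<in># act q u"
        using q by (metis act_eq_empty_iff multiset_nonemptyE)
      then have "d \<in># mul p' q"
        using u by (auto simp: in_mul_iff simp flip: eq)
      then obtain u' where "u' \<in># p'" "d \<in># act q u'"
        by (auto simp: in_mul_iff)
      with tails[OF u] d show "u \<in># p'" by auto
    next
      fix u' assume u': "u' \<in># p'"
      obtain d where d: "d \<in># act q u'"
        using q by (metis act_eq_empty_iff multiset_nonemptyE)
      then have "d \<in># mul p q"
        using u' by (auto simp: in_mul_iff eq)
      then obtain u where "u \<in># p" "d \<in># act q u"
        by (auto simp: in_mul_iff)
      with tails[OF _ u'] d show "u' \<in># p" by auto
    qed
    then have "p = p'"
      using Lead.hyps p' by (intro multiplicity_free_eqI) (auto simp: reduced_polys_def)
    with s' show ?case by simp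
  }
qed

lemma mul_in_reduced_polys_if:
  assumes "p \<in> reduced_polys X" "\<And>s. s \<in># p \<Longrightarrow> act q s \<in> reduced_polys X"
  shows "mul p q \<in> reduced_polys X"
  using assms
proof (induction p)
  case (add s p)
  have "set_mset (act q s) \<inter> set_mset (mul p q) = {}"
  proof (rule ccontr)
    assume "set_mset (act q s) \<inter> set_mset (mul p q) \<noteq> {}"
    then obtain e u where "e \<in># act q s" "u \<in># p" "e \<in># act q u"
      by (auto simp: in_mul_iff)
    then have "s = u"
      using add.prems(1) by (intro act_disjoint[of s X u e q]) (auto simp: reduced_polys_def)
    with \<open>u \<in># p\<close> add.prems(1) show False by simp
  qed
  moreover have "mul p q \<in> reduced_polys X" "act q s \<in> reduced_polys X"
    using add by auto
  ultimately show ?case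
    by (auto simp: reduced_polys_def multiplicity_free_add)
qed auto

lemma act_in_reduced_polys:
  "s \<in> reduced_summands X \<Longrightarrow> q \<in> reduced_polys X \<Longrightarrow> act q s \<in> reduced_polys X"
proof (induction rule: reduced_summands.induct)
  case (Lead x p)
  then have "mul p q \<in> reduced_polys X"
    by (intro mul_in_reduced_polys_if) (auto simp: reduced_polys_def)
  with Lead show ?case
    by (cases "q = {#}") (auto simp: act_Lead)
qed auto

lemma mul_in_reduced_polys:
  "p \<in> reduced_polys X \<Longrightarrow> q \<in> reduced_polys X \<Longrightarrow> mul p q \<in> reduced_polys X"
  by (intro mul_in_reduced_polys_if act_in_reduced_polys) (auto simp: reduced_polys_def)

definition merge :: "'a multiset \<Rightarrow> 'a multiset \<Rightarrow> 'a multiset" where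
  "merge p q = p + filter_mset (\<lambda>s. s \<notin># p) q"

lemma set_mset_merge [simp]: "set_mset (merge p q) = set_mset p \<union> set_mset q"
  by (auto simp: merge_def)

lemma merge_empty [simp]: "merge p {#} = p" "merge {#} q = q"
  by (auto simp: merge_def)

lemma multiplicity_free_merge:
  "multiplicity_free p \<Longrightarrow> multiplicity_free q \<Longrightarrow> multiplicity_free (merge p q)"
  by (auto simp: merge_def multiplicity_free_add multiplicity_free_filter)

lemma merge_in_reduced_polys:
  "p \<in> reduced_polys X \<Longrightarrow> q \<in> reduced_polys X \<Longrightarrow> merge p q \<in> reduced_polys X"
  by (auto simp: reduced_polys_def multiplicity_free_merge)

text \<open>Reduced polynomials are determined by their sets of summands, and on these sets \<open>merge\<close> is
  union. Right distributivity holds because both sides are reduced and have the same set of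
  summands.\<close>

lemma merge_identities:
  assumes "p \<in> reduced_polys X" "q \<in> reduced_polys X" "r \<in> reduced_polys X"
  shows "merge p (merge q r) = merge (merge p q) r" "merge p q = merge q p" "merge p p = p"
    and "mul (merge p q) r = merge (mul p r) (mul q r)"
  using assms
  by (auto intro!: multiplicity_free_eqI reduced_polysD(1)[of _ X] merge_in_reduced_polys
      mul_in_reduced_polys simp: in_mul_iff)

primrec expand_id :: "'a tm \<Rightarrow> 'a summand multiset" where
  "expand_id (Var x) = {#Lead x {#Unit#}#}"
| "expand_id Zero = {#}"
| "expand_id One = {#Unit#}"
| "expand_id (s \<^bold>+ t) = merge (expand_id s) (expand_id t)"
| "expand_id (s \<^bold>\<times> t) = mul (expand_id s) (expand_id t)"

lemma expand_id_in_reduced_polys: "t \<in> T X \<Longrightarrow> expand_id t \<in> reduced_polys X"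
  by (induction t) (auto intro: mul_in_reduced_polys merge_in_reduced_polys)

lemma expand_id_pairs:
  assumes "(s, t) \<in> E_pairs X \<union> rd_pairs X \<union> id_pairs X"
  shows "expand_id s = expand_id t"
proof -
  note merge_identities[of _ X, OF expand_id_in_reduced_polys expand_id_in_reduced_polys
      expand_id_in_reduced_polys]
  with assms show ?thesis
    unfolding E_pairs_def rd_pairs_def id_pairs_def by (auto simp: mul_assoc)
qed

lemma reduced_poly_in_image:
  assumes "\<And>s. s \<in># p \<Longrightarrow> {#s#} \<in> expand_id ` T X" "multiplicity_free p"
  shows "p \<in> expand_id ` T X"
  using assms
proof (induction p)
  case empty
  show ?case
    by (rule image_eqI[of _ _ Zero]) auto
next
  case (add s p)
  then obtain t u where "t \<in> T X" "u \<in> T X" "p = expand_id t" "{#s#} = expand_id u"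
    by (metis (no_types, lifting) image_iff multiplicity_free_simps(2) union_iff add_mset_add_single
        insert_DiffM2 multi_member_last)
  moreover have "add_mset s p = merge p {#s#}"
    using add.prems(2) by (simp add: merge_def)
  ultimately show ?case
    by (intro image_eqI[of _ _ "t \<^bold>+ u"]) auto
qed

lemma reduced_summand_in_image: "s \<in> reduced_summands X \<Longrightarrow> {#s#} \<in> expand_id ` T X"
proof (induction rule: reduced_summands.induct)
  case Unit
  show ?case
    by (rule image_eqI[of _ _ One]) auto
next
  case (Lead x p)
  then obtain t where "t \<in> T X" "p = expand_id t"
    using reduced_poly_in_image by blast
  with Lead show ?case
    by (intro image_eqI[of _ _ "Var x \<^bold>\<times> t"]) (auto simp: act_Lead)
qed

lemma expand_id_image: "expand_id ` T X = reduced_polys X"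
proof
  show "reduced_polys X \<subseteq> expand_id ` T X"
    by (auto simp: reduced_polys_def intro!: reduced_poly_in_image reduced_summand_in_image)
qed (auto intro: expand_id_in_reduced_polys)


section \<open>The classes of id-reduced polynomial terms\<close>

lemma expand_PT_inject:
  assumes "s \<in> PT X" "t \<in> PT X" "expand s = expand t"
  shows "s \<approx> t"
  using PT_ac_poly_term[OF assms(1)] ac_sym[OF PT_ac_poly_term[OF assms(2)]] assms(3)
  by (metis rtranclp_trans)

lemma expand_monomial:
  "m \<in> monomial_terms X \<Longrightarrow> \<exists>x p. expand m = {#Lead x p#}"
proof (induction rule: monomial_terms.induct)
  case (2 s t)
  then show ?case by (auto simp: act_Lead)
qed auto

text \<open>A monomial in front of a polynomial keeps that polynomial together as a single tail, which
  is why product polynomials are the indecomposable constituents of sums.\<close>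

lemma expand_monomial_mul:
  assumes "m \<in> monomial_terms X" "t \<in> PT X" "t \<noteq> Zero"
  shows "\<exists>s. expand (m \<^bold>\<times> t) = {#s#}"
proof -
  have "expand t \<noteq> {#}"
    using expand_PT_inject[of t X Zero] assms by auto
  then show ?thesis
    using expand_monomial[OF assms(1)] by (auto simp: act_Lead)
qed

lemma PT_AddD: "s \<^bold>+ t \<in> PT X \<Longrightarrow> s \<in> PT X \<and> t \<in> PT X"
  by (auto elim: PT.cases monomial_terms.cases)

lemma monomial_terms_Mul [simp]:
  "s \<^bold>\<times> t \<in> monomial_terms X \<longleftrightarrow> s \<in> monomial_terms X \<and> t \<in> monomial_terms X"
  by (auto intro: monomial_terms.intros elim: monomial_terms.cases)

lemma PT_MulD: "s \<^bold>\<times> t \<in> PT X \<Longrightarrow> s \<in> monomial_terms X \<and> t \<in> PT X \<and> t \<noteq> Zero"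
  by (auto elim!: PT.cases intro: PT.monomial dest: monomial_terms_ST)

lemma bracketed_sum_PT:
  "bracketed_sum ts t \<Longrightarrow> t \<in> PT X \<Longrightarrow> set ts \<subseteq> PT X \<and> expand t = (\<Sum>u\<leftarrow>ts. expand u)"
  by (induction rule: bracketed_sum.induct) (auto dest: PT_AddD)

lemma expand_monomial_reduced: "m \<in> monomial_terms X \<Longrightarrow> expand m \<in> reduced_polys X"
  by (induction rule: monomial_terms.induct) (auto intro: mul_in_reduced_polys)

text \<open>The pairwise AC-inequivalent members of a sum-product decomposition are the summands of the value,
  and AC-inequivalent polynomial terms have different values; so the summands are distinct.\<close>

lemma expand_ST_id: "t \<in> ST_id X \<Longrightarrow> t \<in> PT X \<Longrightarrow> expand t \<in> reduced_polys X"
proof (induction rule: ST_id.induct)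
  case (sum t ts)
  have ts: "set ts \<subseteq> product_terms X \<union> Var ` X \<union> {One}" "set ts \<subseteq> PT X"
      "expand t = (\<Sum>u\<leftarrow>ts. expand u)"
    using sum.hyps(2) bracketed_sum_PT sum.prems by (auto simp: sum_product_decomposition_def)
  have "\<exists>s. expand u = {#s#}" if "u \<in> set ts" for u
  proof -
    have u: "u \<in> product_terms X \<union> Var ` X \<union> {One}" "u \<in> PT X"
      using ts that by auto
    then show ?thesis
      using PT_MulD expand_monomial_mul by (fastforce simp: product_terms_def simp del: expand.simps(5))
  qed
  then obtain f where f: "expand u = {#f u#}" if "u \<in> set ts" for u
    by metis
  have "(\<Sum>u\<leftarrow>ts. expand u) = mset (map f ts)"
    using f by (induction ts) auto
  moreover have "multiplicity_free (mset (map f ts))"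
  proof -
    have "f (ts ! i) \<noteq> f (ts ! j)" if "i < j" "j < length ts" for i j
    proof
      assume eq: "f (ts ! i) = f (ts ! j)"
      have mem: "ts ! i \<in> set ts" "ts ! j \<in> set ts"
        using that by auto
      with eq have "ts ! i \<approx> ts ! j"
        using ts(2) by (intro expand_PT_inject[of _ X]) (auto simp: f)
      with mem ts(2) have "(ts ! i, ts ! j) \<in> eq_AC X"
        using PT_subset_ST by (auto simp: eq_AC_def)
      with sum.hyps(4)[OF that] show False by simp
    qed
    then have "distinct (map f ts)"
      by (auto simp: distinct_conv_nth neq_iff) metis
    then show ?thesis
      by (simp only: multiplicity_free_mset)
  qed
  moreover have "f u \<in> reduced_summands X" if u: "u \<in> set ts" for u
  proof -
    obtain i where i: "i < length ts" "u = ts ! i"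
      using u by (auto simp: in_set_conv_nth)
    have "expand (ts ! i) \<in> reduced_polys X"
      using sum.IH[OF i(1)] ts(2) i u by blast
    with f[OF u] i show ?thesis by simp
  qed
  ultimately show ?case
    using ts(3) by (auto simp: reduced_polys_def)
next
  case (prod s t)
  then show ?case
    using PT_MulD[of s t X] by (auto intro: mul_in_reduced_polys expand_monomial_reduced)
qed (auto intro: expand_monomial_reduced)

lemma bracketed_list_sum: "ts \<noteq> [] \<Longrightarrow> Zero \<notin> set ts \<Longrightarrow> bracketed_sum ts (list_sum ts)"
proof (induction ts rule: list_nonempty_induct)
  case (single t)
  then show ?case by (simp add: bracketed_sum.intros)
next
  case (cons t ts)
  then have "list_sum ts \<noteq> Zero"
    by (cases ts) auto
  with cons have "list_sum (t # ts) = t \<^bold>+ list_sum ts"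
    by (auto simp: simple_add_def[of t])
  with cons bracketed_sum.intros(2)[OF bracketed_sum.intros(1)[of t], of ts "list_sum ts"]
  show ?case by simp
qed

lemma summand_term_shape:
  assumes "s \<in> summands X"
  shows "summand_term s \<in> product_terms X \<union> Var ` X \<union> {One}"
proof (cases s)
  case (Lead x p)
  with assms have xp: "x \<in> X" "p \<in> polys X" "p \<noteq> {#}" by auto
  show ?thesis
  proof (cases "p = {#Unit#}")
    case True
    with Lead xp show ?thesis by (auto simp: summand_term_Lead)
  next
    case False
    with xp have p: "poly_term p \<in> ST X - {Zero, One}" "Var x \<in> ST X - {Zero, One}"
      by (simp_all add: poly_term_eq_constant_iff poly_term_in_ST)
    have "summand_term s = Var x \<^bold>\<times> poly_term p"
      using p
      by (simp add: Lead summand_term_Lead simple_mul_def)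
    moreover have "Var x \<^bold>\<times> poly_term p \<in> product_terms X"
      using p ST_mul[OF p(2,1)] unfolding product_terms_def by blast
    ultimately show ?thesis by simp
  qed
qed auto

text \<open>Conversely the canonical term of a reduced polynomial is bracketed from the canonical terms of its
  summands, and these are pairwise AC-inequivalent because their values differ.\<close>

lemma poly_term_in_ST_id_if:
  assumes p: "p \<in> reduced_polys X" and summands: "\<And>s. s \<in># p \<Longrightarrow> summand_term s \<in> ST_id X"
  shows "poly_term p \<in> ST_id X"
proof -
  obtain ts where ts: "mset ts = image_mset summand_term p" "poly_term p = list_sum ts"
    unfolding poly_term_def by (rule term_sum_cases)
  have set_ts: "set ts = summand_term ` set_mset p"
    using ts(1) by (metis set_image_mset set_mset_mset)
  have polys: "p \<in> polys X"
    using p reduced_polys_subset by blast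
  then have summands_p: "s \<in> summands X" if "s \<in># p" for s
    using that by (auto simp: polys_def)
  have nonzero: "Zero \<notin> set ts"
    using summand_term_shape[OF summands_p] by (fastforce simp: set_ts product_terms_def)
  consider "ts = []" | t where "ts = [t]" | t u us where "ts = t # u # us"
    by (metis list.exhaust)
  then show ?thesis
  proof cases
    case 1
    with ts show ?thesis by (simp add: ST_id.zero)
  next
    case (2 t)
    then have "t \<in> summand_term ` set_mset p"
      using set_ts by auto
    with 2 ts(2) summands show ?thesis by auto
  next
    case (3 t u us)
    have ST: "set ts \<subseteq> ST X"
      using set_ts summands ST_id_subset_ST by auto
    have list_sum: "list_sum (u # us) \<in> ST X - {Zero}"
    proof -
      have "list_sum vs \<in> ST X" if "set vs \<subseteq> ST X" for vs
        using that by (induction vs) (auto intro: simple_op_in_ST)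
      from this[of "u # us"] ST 3 nonzero show ?thesis by auto
    qed
    show ?thesis
    proof (rule ST_id.sum)
      have "poly_term p = t \<^bold>+ list_sum (u # us)" "t \<in> ST X - {Zero}"
        using ts 3 nonzero ST by (auto simp: simple_add_def)
      with list_sum show "poly_term p \<in> sum_terms X"
        using poly_term_in_ST[OF polys] unfolding sum_terms_def by blast
      show "sum_product_decomposition X (poly_term p) ts"
        using 3 nonzero ts(2) bracketed_list_sum[of ts] set_ts summand_term_shape[OF summands_p]
        by (auto simp: sum_product_decomposition_def)
      show "ts ! i \<in> ST_id X" if "i < length ts" for i
        using nth_mem[OF that] set_ts summands by auto
      show "(ts ! i, ts ! j) \<notin> eq_AC X" if "i < j" "j < length ts" for i j
      proof -
        have "mset (map expand ts) = image_mset (\<lambda>s. {#s#}) p"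
          using expand_summand_term[OF summands_p]
          by (simp add: ts(1) multiset.map_comp) (auto intro: image_mset_cong)
        moreover have "multiplicity_free (image_mset (\<lambda>s. {#s#}) p)"
          using reduced_polysD(1)[OF p] by (induction p) auto
        ultimately have "distinct (map expand ts)"
          by (metis multiplicity_free_mset)
        then have "expand (ts ! i) \<noteq> expand (ts ! j)"
          using that by (auto simp: distinct_conv_nth)
        then show ?thesis
          using expand_ac by (auto simp: eq_AC_def)
      qed
    qed
  qed
qed

lemma summand_term_in_ST_id: "s \<in> reduced_summands X \<Longrightarrow> summand_term s \<in> ST_id X"
proof (induction rule: reduced_summands.induct)
  case (Lead x p)
  have p: "p \<in> reduced_polys X"
    using Lead by (auto simp: reduced_polys_def)
  with Lead have "poly_term p \<in> ST_id X"
    by (intro poly_term_in_ST_id_if) auto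
  moreover have "Var x \<in> ST_id X"
    using Lead by (intro ST_id.monomial monomial_terms.intros)
  ultimately show ?case
    by (auto simp: summand_term_Lead simple_mul_def intro: ST_id.intros)
qed (auto intro: ST_id.one)

lemma id_reduced_polynomials_eq: "id_reduced_polynomials X = poly_class X ` reduced_polys X"
proof
  show "id_reduced_polynomials X \<subseteq> poly_class X ` reduced_polys X"
    unfolding id_reduced_polynomials_def PT_id_def
    using AC_class_PT(1) expand_ST_id by blast
  show "poly_class X ` reduced_polys X \<subseteq> id_reduced_polynomials X"
  proof clarify
    fix p assume p: "p \<in> reduced_polys X"
    then have "poly_term p \<in> ST_id X"
      using summand_term_in_ST_id by (intro poly_term_in_ST_id_if) (auto simp: reduced_polys_def)
    moreover have "poly_term p \<in> PT X"
      using p reduced_polys_subset by (blast intro: poly_term_in_PT)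
    ultimately show "poly_class X p \<in> id_reduced_polynomials X"
      by (auto simp: id_reduced_polynomials_def PT_id_def poly_class_def)
  qed
qed

abbreviation summand_class_of :: "'a set \<Rightarrow> 'a summand \<Rightarrow> 'a tm set" where
  "summand_class_of X s \<equiv> poly_class X {#s#}"

lemma sum_summand_classes:
  assumes "set ss \<subseteq> summands X"
  shows "sum_AC X (map (summand_class_of X) ss) = poly_class X (mset ss)"
proof -
  have "set (map (\<lambda>s. {#s#}) ss) \<subseteq> polys X"
    using assms by auto
  from sum_poly_classes[OF this] show ?thesis
    by (simp add: comp_def)
qed

text \<open>Each constituent allowed in a decomposition is the class of a single summand, so a decomposition
  merely lists the multiset. Two decompositions differ only in their order, and the result of \<open>add_id\<close> does not depend on their choice.\<close>

lemma id_decomposition_iff: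
  assumes p: "p \<in> reduced_polys X"
  shows "id_decomposition X (poly_class X p) qs \<longleftrightarrow>
    p \<noteq> {#} \<and> (\<exists>ss. mset ss = p \<and> qs = map (summand_class_of X) ss)"
    (is "?L \<longleftrightarrow> ?R")
proof
  assume L: ?L
  have "c \<in> summand_class_of X ` summands X" if "c \<in> set qs" for c
  proof -
    have "c \<in> {one_AC X} \<union> monomials X \<union> product_polynomials X"
      using L that by (auto simp: id_decomposition_def)
    then consider "c = one_AC X" | m where "m \<in> monomial_terms X" "c = AC_class X m"
      | m t where "m \<in> monomial_terms X" "t \<in> PT X - {Zero, One}" "c = AC_class X (m \<^bold>\<times> t)"
      by (auto simp: monomials_def product_polynomials_def product_polynomial_terms_def)
    then show ?thesis
    proof cases
      case 1
      then show ?thesis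
        by (auto simp flip: poly_class_constants)
    next
      case 2
      then obtain s where "expand m = {#s#}"
        using expand_monomial by blast
      with 2 AC_class_PT[of m X] show ?thesis
        using monomial_terms_subset_PT by auto
    next
      case 3
      then obtain s where "expand (m \<^bold>\<times> t) = {#s#}"
        using expand_monomial_mul by blast
      moreover have "m \<^bold>\<times> t \<in> PT X"
        using 3 by (auto intro: PT.prod)
      ultimately show ?thesis
        using AC_class_PT[of "m \<^bold>\<times> t" X] 3 by auto
    qed
  qed
  then have "qs \<in> lists (summand_class_of X ` summands X)"
    by auto
  then obtain ss where ss: "qs = map (summand_class_of X) ss" "set ss \<subseteq> summands X"
    unfolding lists_image by auto
  then have "poly_class X p = poly_class X (mset ss)"
    using L sum_summand_classes by (auto simp: id_decomposition_def)
  then have "p = mset ss"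
    using p ss reduced_polys_subset by (subst (asm) poly_class_inject) (auto simp: polys_def)
  moreover have "qs \<noteq> []"
    using L by (simp add: id_decomposition_def)
  ultimately show ?R
    using ss by auto
next
  assume ?R
  then obtain ss where ss: "mset ss = p" "qs = map (summand_class_of X) ss" "p \<noteq> {#}"
    by blast
  have reduced: "set ss \<subseteq> reduced_summands X" and "distinct ss"
    using p ss(1) by (auto simp: reduced_polys_def)
  then have mem: "set ss \<subseteq> summands X"
    using reduced_summands_subset by blast
  have "inj_on (summand_class_of X) (set ss)"
    using mem by (auto intro!: inj_onI simp: subset_iff)
  then have "distinct qs"
    using \<open>distinct ss\<close> ss(2) by (simp add: distinct_map)
  moreover have "summand_class_of X s \<in> {one_AC X} \<union> monomials X \<union>
      (product_polynomials X \<inter> id_reduced_polynomials X)" if "s \<in> set ss" for s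
  proof -
    have "{#s#} \<in> reduced_polys X"
      using reduced that by auto
    moreover have "variable_classes X \<subseteq> monomials X"
      by (auto simp: variable_classes_def monomials_def intro: monomial_terms.intros)
    moreover have "s \<in> summands X"
      using mem that by auto
    ultimately show ?thesis
      using summand_class[of s X] by (auto simp: id_reduced_polynomials_eq)
  qed
  moreover have "poly_class X p = sum_AC X qs"
    using sum_summand_classes[OF mem] ss by simp
  moreover have "qs \<noteq> []"
    using ss by auto
  ultimately show ?L
    using ss by (auto simp: id_decomposition_def)
qed

lemma add_id_poly_class:
  assumes "p \<in> reduced_polys X" "q \<in> reduced_polys X"
  shows "add_id X (poly_class X p) (poly_class X q) = poly_class X (merge p q)"
proof (cases "p = {#} \<or> q = {#}")
  case True
  have "add_id X (zero_AC X) c = c" "add_id X c (zero_AC X) = c" for c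
    by (simp_all add: add_id_def)
  with True show ?thesis
    by (auto simp: poly_class_constants)
next
  case False
  have polys: "p \<in> polys X" "q \<in> polys X"
    using assms reduced_polys_subset by auto
  have merge: "sum_AC X (map (summand_class_of X) ss @
      filter (\<lambda>c. c \<notin> set (map (summand_class_of X) ss)) (map (summand_class_of X) us))
      = poly_class X (merge p q)" if "mset ss = p" "mset us = q" for ss us
  proof -
    have mem: "set ss \<subseteq> summands X" "set us \<subseteq> summands X"
      using polys that by (auto simp: polys_def)
    then have "filter (\<lambda>c. c \<notin> set (map (summand_class_of X) ss)) (map (summand_class_of X) us)
        = map (summand_class_of X) (filter (\<lambda>s. s \<notin> set ss) us)"
      unfolding filter_map by (intro arg_cong[where f = "map _"] filter_cong refl) fastforce
    then have "map (summand_class_of X) ss @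
        filter (\<lambda>c. c \<notin> set (map (summand_class_of X) ss)) (map (summand_class_of X) us)
        = map (summand_class_of X) (ss @ filter (\<lambda>s. s \<notin> set ss) us)"
      by simp
    moreover have "mset (ss @ filter (\<lambda>s. s \<notin> set ss) us) = merge p q"
      using that by (auto simp: merge_def)
    moreover have "set (ss @ filter (\<lambda>s. s \<notin> set ss) us) \<subseteq> summands X"
      using mem by auto
    ultimately show ?thesis
      using sum_summand_classes by metis
  qed
  obtain ss us where lists: "mset ss = p" "mset us = q"
    using ex_mset by metis
  have "(THE c. \<exists>qs rs. id_decomposition X (poly_class X p) qs \<and>
      id_decomposition X (poly_class X q) rs \<and>
      c = sum_AC X (qs @ filter (\<lambda>r'. r' \<notin> set qs) rs)) = poly_class X (merge p q)"
    unfolding id_decomposition_iff[OF assms(1)] id_decomposition_iff[OF assms(2)]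
  proof (rule the_equality, goal_cases)
    case 1
    show ?case
      using False lists merge[OF lists, symmetric] by blast
  next
    case (2 c)
    then show ?case
      using merge by blast
  qed
  with False polys show ?thesis
    by (simp add: add_id_def poly_class_eq_constant_iff)
qed


section \<open>The free idempotent right-distributive strong bimonoid\<close>

locale idempotent_congruence = right_distributive_congruence +
  assumes id_pairs: "id_pairs X \<subseteq> R"
begin

text \<open>Idempotence of arbitrary terms lets a repeated part of a sum be dropped as a whole.\<close>

lemma poly_term_absorb:
  assumes "p \<in> polys X" "f \<subseteq># p"
  shows "(poly_term (p + f), poly_term p) \<in> R"
proof -
  obtain r where p: "p = r + f"
    using assms(2) by (metis subset_mset.diff_add)
  with assms(1) have mem: "r \<in> polys X" "f \<in> polys X" by auto
  note inT = poly_term_in_T[OF mem(1)] poly_term_in_T[OF mem(2)]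
  have "(poly_term (r + (f + f)), poly_term r \<^bold>+ poly_term (f + f)) \<in> R"
    using mem by (intro poly_term_add_eq) auto
  moreover have "(poly_term f \<^bold>+ poly_term f, poly_term f) \<in> R"
    using id_pairs inT by (auto simp: id_pairs_def)
  then have "(poly_term (f + f), poly_term f) \<in> R"
    using poly_term_add_eq[OF mem(2) mem(2)] trans by blast
  then have "(poly_term r \<^bold>+ poly_term (f + f), poly_term r \<^bold>+ poly_term f) \<in> R"
    using inT by (intro add refl)
  moreover have "(poly_term r \<^bold>+ poly_term f, poly_term (r + f)) \<in> R"
    using mem by (intro sym[OF poly_term_add_eq])
  ultimately show ?thesis
    unfolding p by (simp add: add.assoc) (blast intro: trans)
qed

text \<open>The summands of \<open>q\<close> that occur in \<open>p\<close> form a submultiset of \<open>p\<close> since \<open>q\<close> has no repetitions; they are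
  absorbed by \<open>p\<close>.\<close>

lemma poly_term_merge_eq:
  assumes "p \<in> polys X" "q \<in> polys X" "multiplicity_free q"
  shows "(poly_term (merge p q), poly_term p \<^bold>+ poly_term q) \<in> R"
proof -
  let ?f = "filter_mset (\<lambda>s. s \<in># p) q" and ?g = "filter_mset (\<lambda>s. s \<notin># p) q"
  have mem: "?f \<in> polys X" "?g \<in> polys X"
    using assms(2) by (auto simp: polys_def)
  have "count q s \<le> count p s" if "s \<in># p" for s
    using that assms(3) by (metis Suc_leI One_nat_def count_greater_zero_iff le_trans multiplicity_free_def)
  then have "?f \<subseteq># p"
    by (auto simp: subseteq_mset_def)
  then have "(poly_term (p + ?f), poly_term p) \<in> R"
    using assms(1) by (intro poly_term_absorb)
  then have "(poly_term (p + ?f) \<^bold>+ poly_term ?g, poly_term p \<^bold>+ poly_term ?g) \<in> R"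
    using mem by (intro add refl poly_term_in_T)
  moreover have "(poly_term (p + ?f + ?g), poly_term (p + ?f) \<^bold>+ poly_term ?g) \<in> R"
    using mem assms by (intro poly_term_add_eq) auto
  moreover have "p + ?f + ?g = p + q"
    by (simp add: add.assoc multiset_partition[symmetric])
  moreover have "(poly_term (p + q), poly_term p \<^bold>+ poly_term q) \<in> R"
    "(poly_term (merge p q), poly_term p \<^bold>+ poly_term ?g) \<in> R"
    unfolding merge_def using mem assms by (intro poly_term_add_eq; simp)+
  ultimately show ?thesis
    by (metis sym trans)
qed

lemma expand_id_eq: "t \<in> T X \<Longrightarrow> (t, poly_term (expand_id t)) \<in> R"
proof (induction t)
  case (Var x)
  then show ?case
    by (auto simp: summand_term_Lead intro: refl)
next
  case (Add s t)
  then have red: "expand_id s \<in> reduced_polys X" "expand_id t \<in> reduced_polys X"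
    by (auto intro: expand_id_in_reduced_polys)
  have "(s \<^bold>+ t, poly_term (expand_id s) \<^bold>+ poly_term (expand_id t)) \<in> R"
    using Add by (auto intro: add)
  moreover have "(poly_term (expand_id s) \<^bold>+ poly_term (expand_id t),
      poly_term (merge (expand_id s) (expand_id t))) \<in> R"
    using red reduced_polys_subset reduced_polysD(1) by (blast intro: sym[OF poly_term_merge_eq])
  ultimately show ?case
    by (auto intro: trans)
next
  case (Mul s t)
  then have red: "expand_id s \<in> reduced_polys X" "expand_id t \<in> reduced_polys X"
    by (auto intro: expand_id_in_reduced_polys)
  have "(s \<^bold>\<times> t, poly_term (expand_id s) \<^bold>\<times> poly_term (expand_id t)) \<in> R"
    using Mul by (auto intro: mul)
  moreover have "(poly_term (expand_id s) \<^bold>\<times> poly_term (expand_id t),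
      poly_term (mul (expand_id s) (expand_id t))) \<in> R"
    using red reduced_polys_subset by (blast intro: sym[OF poly_term_mul_eq])
  ultimately show ?case
    by (auto intro: trans)
qed (auto intro: refl)

end

lemma evaluation_B_id_rd: "evaluation X (B_id_rd X) (\<lambda>t. poly_class X (expand_id t))"
proof
  show "carrier (B_id_rd X) = (\<lambda>t. poly_class X (expand_id t)) ` T X"
    by (simp add: B_id_rd_def id_reduced_polynomials_eq image_image flip: expand_id_image)
next
  fix s t assume "s \<in> T X" "t \<in> T X"
  then have "expand_id s \<in> polys X" "expand_id t \<in> polys X"
    using expand_id_in_reduced_polys reduced_polys_subset by blast+
  then show "poly_class X (expand_id (s \<^bold>\<times> t)) =
      poly_class X (expand_id s) \<otimes>\<^bsub>B_id_rd X\<^esub> poly_class X (expand_id t)"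
    by (simp add: B_id_rd_def times_rd_poly_class)
next
  fix s t assume "s \<in> T X" "t \<in> T X"
  then have "expand_id s \<in> reduced_polys X" "expand_id t \<in> reduced_polys X"
    by (auto intro: expand_id_in_reduced_polys)
  then show "poly_class X (expand_id (s \<^bold>+ t)) =
      poly_class X (expand_id s) \<oplus>\<^bsub>B_id_rd X\<^esub> poly_class X (expand_id t)"
    unfolding B_id_rd_def by (simp add: add_id_poly_class)
next
  show "poly_class X (expand_id Zero) = \<zero>\<^bsub>B_id_rd X\<^esub>"
    unfolding B_id_rd_def by (simp add: poly_class_constants)
next
  show "poly_class X (expand_id One) = \<one>\<^bsub>B_id_rd X\<^esub>"
    unfolding B_id_rd_def by (simp add: poly_class_constants)
qed

theorem free_idempotent_right_distributive_strong_bimonoid: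
  "strong_bimonoid (FB_id_rd X) \<and> strong_bimonoid (B_id_rd X) \<and> FB_id_rd X \<cong>\<^sub>s\<^sub>b B_id_rd X"
proof -
  interpret evaluation X "B_id_rd X" "\<lambda>t. poly_class X (expand_id t)"
    by (rule evaluation_B_id_rd)
  let ?P = "E_pairs X \<union> rd_pairs X \<union> id_pairs X"
  have P: "?P \<subseteq> T X \<times> T X" "?P \<subseteq> congruence_generated_by X ?P"
    using generating_pairs_subset[of X] by blast (rule generators_subset)
  interpret R: idempotent_congruence X "congruence_generated_by X ?P"
    using bimonoid_congruence_generated_by[OF P(1)] P(2)
    by (auto simp: idempotent_congruence_def idempotent_congruence_axioms_def
        right_distributive_congruence_def right_distributive_congruence_axioms_def)
  show ?thesis
    unfolding FB_id_rd_def eq_E_id_rd_def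
  proof (rule presentation)
    show "(s, t) \<in> congruence_generated_by X ?P"
      if st: "s \<in> T X" "t \<in> T X"
        and eq: "poly_class X (expand_id s) = poly_class X (expand_id t)" for s t
    proof -
      have "expand_id s \<in> polys X" "expand_id t \<in> polys X"
        using st expand_id_in_reduced_polys reduced_polys_subset by blast+
      with eq have "expand_id s = expand_id t" by simp
      then show ?thesis
        using R.expand_id_eq[OF st(1)] R.expand_id_eq[OF st(2)] by (auto intro: R.trans R.sym)
    qed
    show "poly_class X (expand_id s) = poly_class X (expand_id t)" if "(s, t) \<in> ?P" for s t
      using expand_id_pairs[OF that] by simp
  qed (rule P(1), blast)
qed

theorem corollary5p3:
  fixes X :: "'a set"
  assumes "X \<noteq> {}"
  shows "(strong_bimonoid (FB X) \<and> strong_bimonoid (N_sb X) \<and> FB X \<cong>\<^sub>s\<^sub>b N_sb X) \<and>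
    (strong_bimonoid (FB_rd X) \<and> strong_bimonoid (N_rd X) \<and> FB_rd X \<cong>\<^sub>s\<^sub>b N_rd X) \<and>
    (strong_bimonoid (FB_id_rd X) \<and> strong_bimonoid (B_id_rd X) \<and> FB_id_rd X \<cong>\<^sub>s\<^sub>b B_id_rd X)"
  using free_strong_bimonoid free_right_distributive_strong_bimonoid
    free_idempotent_right_distributive_strong_bimonoid
  by blast

end
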